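(* Let $X$ be a smooth manifold (without boundary), $Y$ a Polish space, $\mu\in\mathcal{P}(X)$, $\nu\in\mathcal{P}(Y)$, and let $c\colon X\times Y\to\mathbb{R}_+$ be continuous such that $c(\cdot,y)$ is locally Lipschitz locally uniformly in $y\in Y$, with $T_c(\mu,\nu)<\infty$. Let $\pi\in\mathcal{C}(\mu,\nu)$ be an optimal transport plan, let $$\Sigma_\pi=\{x\in\mathrm{supp}\,\mu \mid \pi\text{ does not induce regularity at }x\}$$ and $$\Gamma_{\pi,c}=\{(x,y)\in\mathrm{supp}\,\pi \mid \nabla_x c(x,y)\text{ exists}\}.$$ If 1) $\mu(\mathrm{supp}\,\mu\setminus\Sigma_\pi)=1$, 2) $M=\mathrm{int}(\mathrm{supp}\,\mu\setminus\Sigma_\pi)$ is connected with $\mathrm{cl}(M)=\mathrm{supp}\,\mu$, 3) $p_X(\Gamma_{\pi,c})$ has full Lebesgue measure in charts of $M$, then the Kantorovich potentials $S_c(\mu,\nu)$ are unique.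
   Context: $X$ is also Polish as a topological space. $\mathcal{P}(X)$ is the set of Borel probability measures; $\mathcal{C}(\mu,\nu)$ is the set of probability measures on $X\times Y$ with marginals $\mu,\nu$; $T_c(\mu,\nu)=\inf_{\pi\in\mathcal{C}(\mu,\nu)}\int c\,\mathrm{d}\pi$, and $\pi$ is optimal if it attains the infimum. $\mathrm{supp}$ is the smallest closed set of full measure; $\mathrm{int}$ and $\mathrm{cl}$ denote interior and closure in $X$; $p_X\colon X\times Y\to X$ is the projection. Kantorovich potentials: for $g\colon Y\to\mathbb{R}\cup\{-\infty\}$ set $g^c(x)=\inf_{y\in Y}c(x,y)-g(y)$, and for $f\colon X\to\mathbb{R}\cup\{-\infty\}$ set $f^c(y)=\inf_{x\in X}c(x,y)-f(x)$. A function $f\colon X\to\mathbb{R}\cup\{-\infty\}$ is $c$-concave on $X$ if $f=g^c$ for some $g\colon Y\to\mathbb{R}\cup\{-\infty\}$ and $f\not\equiv-\infty$. $S_c(\mu,\nu)$ is the set of $c$-concave $f$ with $T_c(\mu,\nu)=\int c\,\mathrm{d}\pi=\int(f(x)+f^c(y))\,\mathrm{d}\pi(x,y)$ for an optimal plan $\pi$ (equivalently, every optimal plan). They are called unique if $f_1-f_2$ is $\mu$-almost surely constant for all $f_1,f_2\in S_c(\mu,\nu)$. Induced regularity: a plan $\pi\in\mathcal{C}(\mu,\nu)$ induces regularity on a relatively open set $U\subset\mathrm{supp}\,\mu$ if there is a compact $K\subset\mathrm{supp}\,\nu$ with $p_X(\mathrm{supp}\,\pi)\cap U=p_X\big(\mathrm{supp}\,\pi\cap(U\times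 K)\big)$. It induces regularity at $x\in\mathrm{supp}\,\mu$ if it induces regularity on some relatively open neighborhood $U\subset\mathrm{supp}\,\mu$ of $x$. Manifold notions: a function on a smooth manifold is locally Lipschitz if it is locally Lipschitz in every chart of an atlas. A family $(f_y)_{y\in Y}$ is locally Lipschitz uniformly in $y$ if each $f_y$ is locally Lipschitz with neighborhoods and Lipschitz constants that do not depend on $y$; it is locally Lipschitz locally uniformly in $y$ if for each compact $K\subset Y$ the functions $f_y$ are locally Lipschitz uniformly in $y\in K$. "$\nabla_x c(x,y)$ exists" means that $x'\mapsto c(x',y)$ is differentiable at $x$ (in charts). A set $A$ has full Lebesgue measure in charts of $M$ if $\mathrm{range}\,\varphi\setminus\varphi(A\cap\mathrm{domain}\,\varphi)$ is a Lebesgue null set for each chart $\varphi$ of an atlas of $M$. *)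

theory Defs
  imports "HOL-Probability.Probability"
begin

section \<open>Smooth manifolds\<close>

text \<open>
  A chart of a space \<open>'x\<close> is a pair of its domain and a coordinate map. The coordinates
  live in a model space \<open>V\<close>, which is either the whole Euclidean space \<open>'e\<close> or \<open>{0}\<close>. The
  latter is there because types of class \<^class>\<open>euclidean_space\<close> have positive dimension,
  so that manifolds of dimension 0 would otherwise be excluded.

  Derivatives are taken at a point within a set that is open in \<open>V\<close>. For \<open>V = UNIV\<close> these are
  the usual derivatives; for \<open>V = {0}\<close> every function is differentiable.
\<close>

type_synonym ('x, 'e) chart = "'x set \<times> ('x \<Rightarrow> 'e)"

definition model_space :: "'e::euclidean_space set \<Rightarrow> bool" where
  "model_space V \<longleftrightarrow> V = UNIV \<or> V = {0}"

primrec times_cont_differentiable_on ::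
  "nat \<Rightarrow> 'e::real_normed_vector set \<Rightarrow> ('e \<Rightarrow> 'f::real_normed_vector) \<Rightarrow> bool" where
  "times_cont_differentiable_on 0 S f \<longleftrightarrow> continuous_on S f"
| "times_cont_differentiable_on (Suc k) S f \<longleftrightarrow>
     f differentiable_on S \<and>
     (\<forall>v. times_cont_differentiable_on k S (\<lambda>u. frechet_derivative f (at u within S) v))"

definition smooth_on :: "'e::real_normed_vector set \<Rightarrow> ('e \<Rightarrow> 'f::real_normed_vector) \<Rightarrow> bool" where
  "smooth_on S f \<longleftrightarrow> (\<forall>k. times_cont_differentiable_on k S f)"

definition chart_on :: "'e::euclidean_space set \<Rightarrow> ('x::topological_space, 'e) chart \<Rightarrow> bool" where
  "chart_on V = (\<lambda>(U, \<phi>). open U \<and> openin (top_of_set V) (\<phi> ` U) \<and>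
     homeomorphism U (\<phi> ` U) \<phi> (inv_into U \<phi>))"

definition smooth_atlas ::
  "'e::euclidean_space set \<Rightarrow> ('x::topological_space, 'e) chart set \<Rightarrow> bool" where
  "smooth_atlas V A \<longleftrightarrow>
     (\<forall>\<kappa>\<in>A. chart_on V \<kappa>) \<and>
     (\<Union>(U, \<phi>)\<in>A. U) = UNIV \<and>
     (\<forall>(U\<^sub>1, \<phi>\<^sub>1)\<in>A. \<forall>(U\<^sub>2, \<phi>\<^sub>2)\<in>A. smooth_on (\<phi>\<^sub>1 ` (U\<^sub>1 \<inter> U\<^sub>2)) (\<phi>\<^sub>2 \<circ> inv_into U\<^sub>1 \<phi>\<^sub>1))"

definition locally_Lipschitz_uniformly ::
  "('x::topological_space, 'e::euclidean_space) chart set \<Rightarrow> 'y set \<Rightarrow> ('y \<Rightarrow> 'x \<Rightarrow> real) \<Rightarrow> bool" where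
  "locally_Lipschitz_uniformly A K F \<longleftrightarrow>
     (\<forall>(U, \<phi>)\<in>A. \<forall>x\<in>U. \<exists>W L. open W \<and> x \<in> W \<and> W \<subseteq> U \<and>
        (\<forall>y\<in>K. L-lipschitz_on (\<phi> ` W) (F y \<circ> inv_into U \<phi>)))"

definition locally_Lipschitz_locally_uniformly ::
  "('x::topological_space, 'e::euclidean_space) chart set \<Rightarrow>
   ('y::topological_space \<Rightarrow> 'x \<Rightarrow> real) \<Rightarrow> bool" where
  "locally_Lipschitz_locally_uniformly A F \<longleftrightarrow>
     (\<forall>K. compact K \<longrightarrow> locally_Lipschitz_uniformly A K F)"

definition gradient_exists ::
  "('x, 'e::euclidean_space) chart set \<Rightarrow> ('x \<Rightarrow> real) \<Rightarrow> 'x \<Rightarrow> bool" where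
  "gradient_exists A f x \<longleftrightarrow>
     (\<forall>(U, \<phi>)\<in>A. x \<in> U \<longrightarrow> (f \<circ> inv_into U \<phi>) differentiable (at (\<phi> x) within \<phi> ` U))"

text \<open>On the zero-dimensional space, Lebesgue measure is the point mass at 0.\<close>

definition lebesgue_null :: "'e::euclidean_space set \<Rightarrow> 'e set \<Rightarrow> bool" where
  "lebesgue_null V N \<longleftrightarrow> (if V = {0} then N = {} else N \<in> null_sets lebesgue)"

text \<open>The open set \<open>M\<close> carries the atlas consisting of the restrictions to \<open>M\<close> of the charts in \<open>A\<close>.\<close>

definition full_lebesgue_measure_in_charts ::
  "'e::euclidean_space set \<Rightarrow> ('x, 'e) chart set \<Rightarrow> 'x set \<Rightarrow> 'x set \<Rightarrow> bool" where
  "full_lebesgue_measure_in_charts V A M S \<longleftrightarrow>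
     (\<forall>(U, \<phi>)\<in>A. lebesgue_null V (\<phi> ` (U \<inter> M) - \<phi> ` (S \<inter> (U \<inter> M))))"


section \<open>Optimal transport\<close>

definition borel_prob :: "'a::topological_space measure \<Rightarrow> bool" where
  "borel_prob \<mu> \<longleftrightarrow> sets \<mu> = sets borel \<and> prob_space \<mu>"

text \<open>In second countable spaces, the intersection below has full measure itself.\<close>

definition msupp :: "'a::topological_space measure \<Rightarrow> 'a set" where
  "msupp \<mu> = \<Inter>{C. closed C \<and> emeasure \<mu> C = emeasure \<mu> (space \<mu>)}"

definition couplings ::
  "'x::topological_space measure \<Rightarrow> 'y::topological_space measure \<Rightarrow> ('x \<times> 'y) measure set" where
  "couplings \<mu> \<nu> = {\<pi>. borel_prob \<pi> \<and> distr \<pi> borel fst = \<mu> \<and> distr \<pi> borel snd = \<nu>}"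

definition plan_cost :: "('x \<Rightarrow> 'y \<Rightarrow> real) \<Rightarrow> ('x \<times> 'y) measure \<Rightarrow> ennreal" where
  "plan_cost c \<pi> = (\<integral>\<^sup>+ (x, y). ennreal (c x y) \<partial>\<pi>)"

definition transport_cost ::
  "('x::topological_space \<Rightarrow> 'y::topological_space \<Rightarrow> real) \<Rightarrow> 'x measure \<Rightarrow> 'y measure \<Rightarrow> ennreal" where
  "transport_cost c \<mu> \<nu> = (INF \<pi>\<in>couplings \<mu> \<nu>. plan_cost c \<pi>)"

definition optimal_plan ::
  "('x::topological_space \<Rightarrow> 'y::topological_space \<Rightarrow> real) \<Rightarrow> 'x measure \<Rightarrow> 'y measure \<Rightarrow>
   ('x \<times> 'y) measure \<Rightarrow> bool" where
  "optimal_plan c \<mu> \<nu> \<pi> \<longleftrightarrow> \<pi> \<in> couplings \<mu> \<nu> \<and> plan_cost c \<pi> = transport_cost c \<mu> \<nu>"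


section \<open>Kantorovich potentials\<close>

text \<open>
  Functions with values in \<open>\<real> \<union> {-\<infinity>}\<close> are \<^typ>\<open>ereal\<close>-valued functions that avoid \<open>\<infinity>\<close>. The
  transform of \<open>f\<close> on the first factor is \<open>c_transform (\<lambda>y x. c x y) f\<close>.
\<close>

definition c_transform :: "('x \<Rightarrow> 'y \<Rightarrow> real) \<Rightarrow> ('y \<Rightarrow> ereal) \<Rightarrow> 'x \<Rightarrow> ereal" where
  "c_transform c g x = (INF y. ereal (c x y) - g y)"

definition c_concave :: "('x \<Rightarrow> 'y \<Rightarrow> real) \<Rightarrow> ('x \<Rightarrow> ereal) \<Rightarrow> bool" where
  "c_concave c f \<longleftrightarrow>
     (\<forall>x. f x \<noteq> \<infinity>) \<and> (\<exists>g. (\<forall>y. g y \<noteq> \<infinity>) \<and> f = c_transform c g) \<and> (\<exists>x. f x \<noteq> -\<infinity>)"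

text \<open>
  The integral of the positive part minus that of the negative part (\<^const>\<open>e2ennreal\<close> maps
  negative numbers to 0). Below, the positive part is dominated by the cost, so that the
  difference \<open>\<infinity> - \<infinity>\<close> does not occur.
\<close>

definition ereal_integral :: "'a measure \<Rightarrow> ('a \<Rightarrow> ereal) \<Rightarrow> ereal" where
  "ereal_integral M h =
     enn2ereal (\<integral>\<^sup>+ z. e2ennreal (h z) \<partial>M) - enn2ereal (\<integral>\<^sup>+ z. e2ennreal (- h z) \<partial>M)"

definition kantorovich_potentials ::
  "('x::topological_space \<Rightarrow> 'y::topological_space \<Rightarrow> real) \<Rightarrow> 'x measure \<Rightarrow> 'y measure \<Rightarrow>
   ('x \<Rightarrow> ereal) set" where
  "kantorovich_potentials c \<mu> \<nu> =
     {f. c_concave c f \<and>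
         (\<exists>\<pi>. optimal_plan c \<mu> \<nu> \<pi> \<and>
              enn2ereal (transport_cost c \<mu> \<nu>) =
                ereal_integral \<pi> (\<lambda>(x, y). f x + c_transform (\<lambda>y x. c x y) f y))}"

text \<open>The equation for the real constant \<open>k\<close> includes that both potentials are finite almost surely.\<close>

definition kantorovich_potentials_unique ::
  "('x::topological_space \<Rightarrow> 'y::topological_space \<Rightarrow> real) \<Rightarrow> 'x measure \<Rightarrow> 'y measure \<Rightarrow> bool" where
  "kantorovich_potentials_unique c \<mu> \<nu> \<longleftrightarrow>
     (\<forall>f\<^sub>1\<in>kantorovich_potentials c \<mu> \<nu>. \<forall>f\<^sub>2\<in>kantorovich_potentials c \<mu> \<nu>.
        \<exists>k::real. AE x in \<mu>. f\<^sub>1 x - f\<^sub>2 x = ereal k)"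


section \<open>Induced regularity\<close>

definition induces_regularity_on ::
  "'x::topological_space measure \<Rightarrow> 'y::topological_space measure \<Rightarrow> ('x \<times> 'y) measure \<Rightarrow>
   'x set \<Rightarrow> bool" where
  "induces_regularity_on \<mu> \<nu> \<pi> U \<longleftrightarrow>
     openin (top_of_set (msupp \<mu>)) U \<and>
     (\<exists>K. compact K \<and> K \<subseteq> msupp \<nu> \<and> fst ` msupp \<pi> \<inter> U = fst ` (msupp \<pi> \<inter> (U \<times> K)))"

definition induces_regularity_at ::
  "'x::topological_space measure \<Rightarrow> 'y::topological_space measure \<Rightarrow> ('x \<times> 'y) measure \<Rightarrow>
   'x \<Rightarrow> bool" where
  "induces_regularity_at \<mu> \<nu> \<pi> x \<longleftrightarrow> (\<exists>U. x \<in> U \<and> induces_regularity_on \<mu> \<nu> \<pi> U)"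

definition irregular_set ::
  "'x::topological_space measure \<Rightarrow> 'y::topological_space measure \<Rightarrow> ('x \<times> 'y) measure \<Rightarrow>
   'x set" where
  "irregular_set \<mu> \<nu> \<pi> = {x \<in> msupp \<mu>. \<not> induces_regularity_at \<mu> \<nu> \<pi> x}"

definition gradient_set ::
  "('x::topological_space, 'e::euclidean_space) chart set \<Rightarrow>
   ('x \<Rightarrow> 'y::topological_space \<Rightarrow> real) \<Rightarrow> ('x \<times> 'y) measure \<Rightarrow> ('x \<times> 'y) set" where
  "gradient_set A c \<pi> = {(x, y). (x, y) \<in> msupp \<pi> \<and> gradient_exists A (\<lambda>x'. c x' y) x}"

end

theory Submission
  imports Defs
begin

text \<open>
  A potential \<open>f\<close> and its transform \<open>f\<^sup>c\<close> satisfy \<open>f x + f\<^sup>c y \<le> c x y\<close> with equality on the support of every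
  optimal plan. Where the plan induces regularity, only a compact set of points \<open>y\<close> matters, so \<open>f\<close>
  inherits a local Lipschitz bound from \<open>c\<close>; upper semicontinuity and the density of the projected
  support extend this bound to all points of \<open>supp \<mu> - \<Sigma>\<^sub>\<pi>\<close>.

  If \<open>(x, y)\<close> lies in the support and \<open>c(\<cdot>, y)\<close> is differentiable at \<open>x\<close>, then \<open>c(\<cdot>, y)\<close> touches two
  potentials \<open>f\<close> and \<open>f'\<close> from above at \<open>x\<close>, up to constants. As this happens at almost every point of
  \<open>M\<close>, the difference \<open>f - f'\<close> is locally constant on \<open>M\<close>, hence constant, and by continuity it is
  constant on \<open>supp \<mu> - \<Sigma>\<^sub>\<pi>\<close>. Rademacher's theorem is avoided: the forward difference quotients of
  \<open>f\<close> plus the backward ones of \<open>f'\<close> have nonpositive upper limit almost everywhere on almost every line,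
  and integrating them along such a line compares the increments of \<open>f\<close> and \<open>f'\<close>.
\<close>

section \<open>Lipschitz functions with common upper contact functions\<close>

text \<open>Only interior points are kept, since there the derivative within the closed interval is
  two-sided. Primitives are needed because \<open>u\<close> and \<open>v\<close> below are merely
  Lipschitz.\<close>

lemma continuous_antiderivative_exists:
  fixes u :: "real \<Rightarrow> real"
  assumes "continuous_on UNIV u"
  shows "\<exists>U. \<forall>t\<in>{a<..<b}. (U has_real_derivative u t) (at t)"
proof -
  obtain U where U: "\<And>t. t \<in> {a..b} \<Longrightarrow> (U has_vector_derivative u t) (at t within {a..b})"
    using antiderivative_continuous[of a b u] assms continuous_on_subset[OF assms] by auto
  have "(U has_real_derivative u t) (at t)" if "t \<in> {a<..<b}" for t
    using U[of t] that
    by (simp add: has_real_derivative_iff_has_vector_derivative at_within_Icc_at)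
  then show ?thesis by blast
qed

text \<open>The integral of \<open>q n\<close> over \<open>{a..b}\<close> is the increment of
  \<open>Q n\<close>, which tends to the increment of \<open>u - v\<close>. At a contact point
  \<open>q n\<close> is eventually at most the sum of a forward and a backward quotient of
  \<open>g\<close>, whose limits cancel. The Lipschitz bound permits dominated convergence.\<close>

lemma common_upper_contact_imp_increment_le:
  fixes u v :: "real \<Rightarrow> real"
  assumes "a \<le> b"
    and u: "L-lipschitz_on UNIV u" and v: "L-lipschitz_on UNIV v"
    and contact: "AE t in lborel. t \<in> {a<..<b} \<longrightarrow> (\<exists>g. g differentiable at t \<and>
      (\<forall>\<^sub>F s in nhds t. u s - u t \<le> g s - g t \<and> v s - v t \<le> g s - g t))"
  shows "u b - u a \<le> v b - v a"
proof -
  define h where "h n = inverse (real (Suc n))" for n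
  have h0: "h n > 0" "h n \<le> 1" for n
    by (auto simp: h_def field_simps)
  have hlim: "h \<longlonglongrightarrow> 0"
    unfolding h_def by (rule LIMSEQ_inverse_real_of_nat)
  have h_at: "filterlim h (at 0) sequentially"
    using hlim h0(1) by (auto simp: filterlim_at less_imp_neq[THEN not_sym] intro!: always_eventually)
  have mh_at: "filterlim (\<lambda>n. - h n) (at 0) sequentially"
    using tendsto_minus[OF hlim] h0(1) by (auto simp: filterlim_at less_imp_neq[THEN not_sym] intro!: always_eventually)
  have quot_lim: "(\<lambda>n. (g (t + h n) - g t) / h n) \<longlonglongrightarrow> D"
    "(\<lambda>n. (g (t - h n) - g t) / h n) \<longlonglongrightarrow> - D"
    if "(g has_real_derivative D) (at t)" for g D t
  proof -
    have *: "((\<lambda>x. (g (t + x) - g t) / x) \<longlongrightarrow> D) (at 0)"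
      using that by (simp add: DERIV_def)
    show "(\<lambda>n. (g (t + h n) - g t) / h n) \<longlonglongrightarrow> D"
      using filterlim_compose[OF * h_at] by simp
    show "(\<lambda>n. (g (t - h n) - g t) / h n) \<longlonglongrightarrow> - D"
      using tendsto_minus[OF filterlim_compose[OF * mh_at]] by simp
  qed
  have cont: "continuous_on UNIV u" "continuous_on UNIV v"
    using u v lipschitz_on_continuous_on by blast+
  have [measurable]: "u \<in> borel_measurable borel" "v \<in> borel_measurable borel"
    using cont by (auto intro: borel_measurable_continuous_onI)
  \<comment> \<open>The shifts \<open>h n\<close> are at most 1, so the enlarged interval contains
    all points \<open>t + h n\<close> and \<open>t - h n\<close> with \<open>t\<close> in
    \<open>{a..b}\<close>.\<close>
  obtain U where U: "\<And>t. t \<in> {a-2<..<b+2} \<Longrightarrow> (U has_real_derivative u t) (at t)"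
    using continuous_antiderivative_exists[OF cont(1)] by blast
  obtain W where W: "\<And>t. t \<in> {a-2<..<b+2} \<Longrightarrow> (W has_real_derivative v t) (at t)"
    using continuous_antiderivative_exists[OF cont(2)] by blast
  \<comment> \<open>The slopes of a common upper contact function cancel in \<open>q n\<close>, whatever \<open>u\<close> and \<open>v\<close> do.\<close>
  define q where "q n t = (u (t + h n) - u t) / h n + (v (t - h n) - v t) / h n" for n t
  define Q where "Q n t = (U (t + h n) - U t) / h n + (W (t - h n) - W t) / h n" for n t
  have Qderiv: "(Q n has_real_derivative q n t) (at t)" if "t \<in> {a..b}" for n t
  proof -
    have "((\<lambda>t. U (t + h n)) has_real_derivative u (t + h n)) (at t)"
      "((\<lambda>t. W (t - h n)) has_real_derivative v (t - h n)) (at t)"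
      using U[of "t + h n"] W[of "t + - h n"] that h0[of n]
      unfolding DERIV_shift by auto
    then show ?thesis
      using that h0[of n] U[of t] W[of t] unfolding Q_def[abs_def] q_def
      by (intro DERIV_add DERIV_cdivide DERIV_diff) auto
  qed
  have qcont: "continuous_on UNIV (q n)" for n
    unfolding q_def
    by (intro continuous_intros continuous_on_compose2[OF cont(1)] continuous_on_compose2[OF cont(2)])
       (use h0 in \<open>auto simp: less_imp_neq[THEN not_sym]\<close>)
  then have qIsCont: "isCont (q n) t" for n t
    by (simp add: continuous_on_eq_continuous_at)
  have int: "has_bochner_integral lborel (\<lambda>t. q n t * indicator {a..b} t) (Q n b - Q n a)" for n
    by (rule has_bochner_integral_FTC_Icc_real) (use assms(1) Qderiv qIsCont in auto)
  have Qlim: "(\<lambda>n. Q n t) \<longlonglongrightarrow> u t - v t" if "t \<in> {a..b}" for t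
    using tendsto_add[OF quot_lim(1)[OF U] quot_lim(2)[OF W], of t t] that
    unfolding Q_def by auto
  have bound: "\<bar>q n t\<bar> \<le> 2 * L" for n t
  proof -
    have "\<bar>u (t + h n) - u t\<bar> \<le> L * h n" "\<bar>v (t - h n) - v t\<bar> \<le> L * h n"
      using lipschitz_onD[OF u, of "t + h n" t] lipschitz_onD[OF v, of "t - h n" t] h0[of n]
      by (auto simp: dist_real_def)
    then have "\<bar>(u (t + h n) - u t) / h n\<bar> \<le> L" "\<bar>(v (t - h n) - v t) / h n\<bar> \<le> L"
      using h0[of n] by (auto simp: abs_divide pos_divide_le_eq)
    then show ?thesis unfolding q_def by linarith
  qed
  have [measurable]: "q n \<in> borel_measurable borel" for n
    using qcont by (rule borel_measurable_continuous_onI)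
  \<comment> \<open>Contact bounds \<open>q n\<close> from above only, so \<open>q n\<close> itself
    may fail to converge. The positive part does converge, and its integral still dominates the
    increment of \<open>Q n\<close>.\<close>
  have lim0: "AE t in lborel. (\<lambda>n. max 0 (q n t) * indicator {a..b} t) \<longlonglongrightarrow> 0"
  proof -
    have "AE t in lborel. t \<noteq> a" "AE t in lborel. t \<noteq> b" by (rule AE_lborel_singleton)+
    with contact show ?thesis
    proof eventually_elim
      case (elim t)
      show ?case
      proof (cases "t \<in> {a<..<b}")
        case True
        with elim obtain g D where D: "(g has_real_derivative D) (at t)"
          and ev: "\<forall>\<^sub>F s in nhds t. u s - u t \<le> g s - g t \<and> v s - v t \<le> g s - g t"
          by (auto simp: real_differentiable_def)
        have "(\<lambda>n. t + h n) \<longlonglongrightarrow> t" "(\<lambda>n. t - h n) \<longlonglongrightarrow> t"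
          using tendsto_add[OF tendsto_const hlim, of t] tendsto_diff[OF tendsto_const hlim, of t] by auto
        from this[THEN eventually_compose_filterlim[OF ev]]
        have "\<forall>\<^sub>F n in sequentially. u (t + h n) - u t \<le> g (t + h n) - g t"
          "\<forall>\<^sub>F n in sequentially. v (t - h n) - v t \<le> g (t - h n) - g t"
          by (simp_all add: eventually_conj_iff)
        then have upper: "\<forall>\<^sub>F n in sequentially. max 0 (q n t) \<le>
            max 0 ((g (t + h n) - g t) / h n + (g (t - h n) - g t) / h n)"
          by eventually_elim
             (use h0 in \<open>simp add: q_def max.coboundedI2 add_mono divide_right_mono less_imp_le\<close>)
        have "(\<lambda>n. max 0 ((g (t + h n) - g t) / h n + (g (t - h n) - g t) / h n)) \<longlonglongrightarrow> max 0 (D + - D)"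
          by (intro tendsto_intros quot_lim D)
        then have "(\<lambda>n. max 0 (q n t)) \<longlonglongrightarrow> 0"
          using upper by (intro tendsto_sandwich[OF _ upper tendsto_const]) auto
        then show ?thesis by (intro tendsto_mult_left_zero)
      qed (use elim in \<open>auto simp: indicator_def\<close>)
    qed
  qed
  have dom: "integrable lborel (\<lambda>t. 2 * L * indicator {a..b} t)"
    by (intro integrable_mult_right) (simp add: integrable_indicator_iff emeasure_lborel_Icc_eq)
  have bd: "norm (max 0 (q n t) * indicator {a..b} t) \<le> 2 * L * indicator {a..b} t" for n t
    using bound[of n t] by (auto simp: indicator_def)
  have conv: "(\<lambda>n. \<integral>t. max 0 (q n t) * indicator {a..b} t \<partial>lborel) \<longlonglongrightarrow> (\<integral>t. 0 \<partial>(lborel::real measure))"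
    by (rule integral_dominated_convergence[OF _ _ dom lim0]) (use bd in auto)
  have intm: "integrable lborel (\<lambda>t. max 0 (q n t) * indicator {a..b} t)" for n
    by (rule Bochner_Integration.integrable_bound[OF dom])
       (auto intro!: AE_I2 order_trans[OF bd order_trans[OF abs_ge_self]] simp flip: real_norm_def)
  have "Q n b - Q n a \<le> (\<integral>t. max 0 (q n t) * indicator {a..b} t \<partial>lborel)" for n
    unfolding has_bochner_integral_integral_eq[OF int, symmetric]
    by (intro integral_mono intm integrable.intros[OF int])
       (auto simp: indicator_def)
  moreover have "(\<lambda>n. Q n b - Q n a) \<longlonglongrightarrow> (u b - v b) - (u a - v a)"
    using assms(1) by (intro tendsto_diff Qlim) auto
  ultimately have "(u b - v b) - (u a - v a) \<le> 0"
    using LIMSEQ_le[OF _ conv] by fastforce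
  then show ?thesis by simp
qed

text \<open>For each fixed \<open>t\<close> this is translation invariance of Lebesgue measure;
  Fubini then exchanges the two almost-everywhere quantifiers.\<close>

lemma AE_line_avoids_null_set:
  fixes v :: "'e::euclidean_space"
  assumes "N \<in> null_sets lborel"
  shows "AE x in lborel. AE t in (lborel :: real measure). x + t *\<^sub>R v \<notin> N"
proof -
  have [measurable]: "N \<in> sets borel" using assms by auto
  have "AE x in lborel. x + t *\<^sub>R v \<notin> N" for t
  proof -
    have "AE x in distr lborel borel ((+) (t *\<^sub>R v)). x \<notin> N"
      unfolding lborel_distr_plus using assms by (rule AE_not_in)
    then show ?thesis
      by (subst (asm) AE_distr_iff) (auto simp: add.commute)
  qed
  moreover have "{z \<in> space (lborel \<Otimes>\<^sub>M lborel). fst z + snd z *\<^sub>R v \<notin> N} \<in> sets (lborel \<Otimes>\<^sub>M (lborel::real measure))"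
    by measurable
  ultimately show ?thesis
    using lborel_pair.AE_commute[of "\<lambda>x t. x + t *\<^sub>R v \<notin> N"] by auto
qed

text \<open>The segment from \<open>p\<close> to \<open>q\<close> may lie inside \<open>N\<close>,
  but almost every parallel segment meets \<open>N\<close> in a null set of parameters. The
  one-dimensional comparison applies to those that start near \<open>p\<close>, and Lipschitz
  continuity carries the result over to \<open>p\<close> and \<open>q\<close>.\<close>

lemma common_upper_contact_imp_difference_eq:
  fixes u v :: "'e::euclidean_space \<Rightarrow> real"
  assumes B: "open B" "convex B"
    and u: "L-lipschitz_on B u" and v: "L-lipschitz_on B v"
    and N: "N \<in> null_sets lebesgue"
    and contact: "\<And>z. z \<in> B - N \<Longrightarrow> \<exists>g. g differentiable at z \<and>
      (\<forall>w\<in>B. u w - u z \<le> g w - g z \<and> v w - v z \<le> g w - g z)"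
    and p: "p \<in> B" and q: "q \<in> B"
  shows "u p - v p = u q - v q"
proof -
  \<comment> \<open>A Lebesgue null set need not be Borel; the Fubini argument uses a Borel null set
    that contains it.\<close>
  obtain N' where N': "N' \<in> null_sets lborel" "N \<subseteq> N'"
    using N unfolding null_sets_completion_iff2 by auto
  define w where "w = q - p"
  obtain e1 where e1: "e1 > 0" "ball p e1 \<subseteq> B" using B(1) p openE by blast
  obtain e2 where e2: "e2 > 0" "ball q e2 \<subseteq> B" using B(1) q openE by blast
  define e where "e = min e1 e2"
  have e: "e > 0" "ball p e \<subseteq> B" "ball q e \<subseteq> B"
    using e1 e2 by (auto simp: e_def)
  have L: "L \<ge> 0" using u by (rule lipschitz_on_nonneg)
  have line: "u (x + w) - u x = v (x + w) - v x"
    if x: "x \<in> ball p e" and ae: "AE t in (lborel :: real measure). x + t *\<^sub>R w \<notin> N'" for x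
  proof -
    \<comment> \<open>Clamping the parameter keeps the path inside \<open>B\<close> for all real
      \<open>t\<close>, as the comparison on the line asks for functions that are Lipschitz
      everywhere. On the open unit interval the path is affine, so contact functions can be pulled
      back along the affine map.\<close>
    define k where "k t = max 0 (min 1 t)" for t :: real
    define \<gamma> where "\<gamma> t = x + k t *\<^sub>R w" for t
    have xw: "x \<in> B" "x + w \<in> B"
      using x e(2,3) by (auto simp: w_def dist_norm algebra_simps)
    have \<gamma>B: "\<gamma> t \<in> B" for t
    proof -
      have "\<gamma> t = (1 - k t) *\<^sub>R x + k t *\<^sub>R (x + w)"
        by (simp add: \<gamma>_def algebra_simps)
      also have "\<dots> \<in> B"
        using B(2) xw by (rule convexD) (auto simp: k_def)
      finally show ?thesis .
    qed
    have \<gamma>_dist: "dist (\<gamma> s) (\<gamma> t) \<le> norm w * dist s t" for s t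
    proof -
      have "dist (\<gamma> s) (\<gamma> t) = \<bar>k s - k t\<bar> * norm w"
        by (simp add: \<gamma>_def dist_norm flip: scaleR_diff_left)
      also have "\<dots> \<le> dist s t * norm w"
        by (intro mult_right_mono) (auto simp: k_def dist_real_def)
      finally show ?thesis by (simp add: mult.commute)
    qed
    have \<gamma>_lip: "(L * norm w)-lipschitz_on UNIV (\<lambda>t. f (\<gamma> t))" if f: "L-lipschitz_on B f" for f :: "'e \<Rightarrow> real"
    proof (rule lipschitz_onI)
      fix s t
      have "dist (f (\<gamma> s)) (f (\<gamma> t)) \<le> L * dist (\<gamma> s) (\<gamma> t)"
        using lipschitz_onD[OF f] \<gamma>B by blast
      also have "\<dots> \<le> L * (norm w * dist s t)"
        using L \<gamma>_dist by (intro mult_left_mono) auto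
      finally show "dist (f (\<gamma> s)) (f (\<gamma> t)) \<le> L * norm w * dist s t" by (simp add: mult.assoc)
    qed (use L in simp)
    have \<gamma>_contact: "AE t in lborel. t \<in> {0<..<1} \<longrightarrow> (\<exists>g. g differentiable at t \<and>
      (\<forall>\<^sub>F s in nhds t. u (\<gamma> s) - u (\<gamma> t) \<le> g s - g t \<and> v (\<gamma> s) - v (\<gamma> t) \<le> g s - g t))"
      using ae
    proof eventually_elim
      case (elim t)
      show ?case
      proof
        assume t: "t \<in> {0<..<1}"
        then have \<gamma>t: "\<gamma> t = x + t *\<^sub>R w" by (simp add: \<gamma>_def k_def)
        with elim N' \<gamma>B[of t] have "\<gamma> t \<in> B - N" by auto
        then obtain g where g: "g differentiable at (\<gamma> t)"
          and le: "\<And>z. z \<in> B \<Longrightarrow> u z - u (\<gamma> t) \<le> g z - g (\<gamma> t) \<and> v z - v (\<gamma> t) \<le> g z - g (\<gamma> t)"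
          using contact by blast
        have "(\<lambda>s. x + s *\<^sub>R w) differentiable at t"
          by (intro derivative_intros)
        then have "(g \<circ> (\<lambda>s. x + s *\<^sub>R w)) differentiable at t"
          by (rule differentiable_chain_at) (use g \<gamma>t in simp)
        moreover have "\<forall>\<^sub>F s in nhds t. s \<in> {0<..<1}"
          using t by (intro eventually_nhds_in_open) auto
        then have "\<forall>\<^sub>F s in nhds t.
          u (\<gamma> s) - u (\<gamma> t) \<le> (g \<circ> (\<lambda>s. x + s *\<^sub>R w)) s - (g \<circ> (\<lambda>s. x + s *\<^sub>R w)) t \<and>
          v (\<gamma> s) - v (\<gamma> t) \<le> (g \<circ> (\<lambda>s. x + s *\<^sub>R w)) s - (g \<circ> (\<lambda>s. x + s *\<^sub>R w)) t"
        proof eventually_elim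
          case (elim s)
          then have "\<gamma> s = x + s *\<^sub>R w" by (simp add: \<gamma>_def k_def)
          with le[OF \<gamma>B[of s]] \<gamma>t show ?case by simp
        qed
        ultimately show "\<exists>g. g differentiable at t \<and>
          (\<forall>\<^sub>F s in nhds t. u (\<gamma> s) - u (\<gamma> t) \<le> g s - g t \<and> v (\<gamma> s) - v (\<gamma> t) \<le> g s - g t)"
          by blast
      qed
    qed
    have "u (\<gamma> 1) - u (\<gamma> 0) \<le> v (\<gamma> 1) - v (\<gamma> 0)"
      by (rule common_upper_contact_imp_increment_le[OF _ \<gamma>_lip[OF u] \<gamma>_lip[OF v] \<gamma>_contact]) simp
    \<comment> \<open>The contact condition is symmetric in \<open>u\<close> and \<open>v\<close>,
      so their roles can be exchanged.\<close>
    moreover have "v (\<gamma> 1) - v (\<gamma> 0) \<le> u (\<gamma> 1) - u (\<gamma> 0)"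
      by (rule common_upper_contact_imp_increment_le[OF _ \<gamma>_lip[OF v] \<gamma>_lip[OF u]])
         (use \<gamma>_contact in \<open>auto simp: conj_commute\<close>)
    ultimately show ?thesis by (simp add: \<gamma>_def k_def)
  qed
  define D where "D = (u q - u p) - (v q - v p)"
  \<comment> \<open>Moving the endpoints to \<open>x\<close> and \<open>x + w\<close> costs at most
    \<open>L * d\<close> for each of the two functions at each of the two ends.\<close>
  have small: "\<bar>D\<bar> \<le> 4 * L * d" if d: "0 < d" "d \<le> e" for d
  proof -
    obtain N2 where N2: "N2 \<in> null_sets lborel"
      "{x. \<not> (AE t in (lborel :: real measure). x + t *\<^sub>R w \<notin> N')} \<subseteq> N2"
      using AE_line_avoids_null_set[OF N'(1), of w] unfolding eventually_ae_filter by auto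
    have "\<not> ball p d \<subseteq> N2"
    proof
      assume "ball p d \<subseteq> N2"
      moreover have "negligible N2"
        using N2(1) by (simp add: negligible_iff_null_sets null_sets_completionI)
      ultimately have "negligible (ball p d)" by (rule negligible_subset[rotated])
      then show False using open_not_negligible[of "ball p d"] d by simp
    qed
    then obtain x where x: "x \<in> ball p d" "AE t in (lborel :: real measure). x + t *\<^sub>R w \<notin> N'"
      using N2(2) by blast
    have xw: "x \<in> B" "x + w \<in> B" "dist x p \<le> d" "dist (x + w) q \<le> d"
      using x d e by (auto simp: w_def dist_norm algebra_simps norm_minus_commute)
    have near: "\<bar>f y - f z\<bar> \<le> L * d" if "L-lipschitz_on B f" "y \<in> B" "z \<in> B" "dist y z \<le> d"
      for f :: "'e \<Rightarrow> real" and y z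
      using lipschitz_onD[OF that(1-3)] mult_left_mono[OF that(4) L] by (simp add: dist_real_def)
    have "u (x + w) - u x = v (x + w) - v x" using x d by (intro line) auto
    then show ?thesis
      using near[OF u xw(1) p xw(3)] near[OF v xw(1) p xw(3)]
        near[OF u xw(2) q xw(4)] near[OF v xw(2) q xw(4)]
      unfolding D_def by linarith
  qed
  have "\<bar>D\<bar> \<le> 0"
  proof (rule tendsto_lowerbound)
    show "((\<lambda>d. 4 * L * d) \<longlongrightarrow> 0) (at_right 0)"
      by (auto intro!: tendsto_eq_intros)
    show "\<forall>\<^sub>F d in at_right 0. \<bar>D\<bar> \<le> 4 * L * d"
      using small e(1) by (auto simp: eventually_at_right_field intro!: exI[of _ e])
  qed simp
  then show ?thesis by (simp add: D_def)
qed

section \<open>Supports and couplings\<close>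

lemma borel_prob_space: "borel_prob \<mu> \<Longrightarrow> space \<mu> = UNIV"
  by (metis borel_prob_def sets_eq_imp_space_eq space_borel)

text \<open>The complement of an open null set is one of the closed sets whose intersection is the
  support.\<close>

lemma emeasure_open_msupp_nonzero:
  assumes "borel_prob \<mu>" "open G" "x \<in> G" "x \<in> msupp \<mu>"
  shows "emeasure \<mu> G \<noteq> 0"
proof
  interpret prob_space \<mu> using assms(1) by (simp add: borel_prob_def)
  assume "emeasure \<mu> G = 0"
  moreover have "G \<in> sets \<mu>" using assms by (simp add: borel_prob_def)
  ultimately have "emeasure \<mu> (- G) = emeasure \<mu> (space \<mu>)"
    using emeasure_compl[of G \<mu>] borel_prob_space[OF assms(1)] by (simp add: Compl_eq_Diff_UNIV)
  with assms(2) have "msupp \<mu> \<subseteq> - G"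
    unfolding msupp_def by (intro Inter_lower) (simp add: closed_Compl)
  with assms(3,4) show False by auto
qed

text \<open>The complement of the support is covered by open null sets, and by the Lindelof property
  countably many of them suffice.\<close>

lemma AE_in_msupp:
  fixes \<mu> :: "'a::second_countable_topology measure"
  assumes "borel_prob \<mu>"
  shows "AE x in \<mu>. x \<in> msupp \<mu>"
proof -
  interpret prob_space \<mu> using assms by (simp add: borel_prob_def)
  have [simp]: "sets \<mu> = sets borel" "space \<mu> = UNIV"
    using assms borel_prob_space by (auto simp: borel_prob_def)
  define F where "F = {G. open G \<and> emeasure \<mu> G = 0}"
  obtain F' where F': "F' \<subseteq> F" "countable F'" "\<Union>F' = \<Union>F"
    using Lindelof[of F] by (auto simp: F_def)
  have "- msupp \<mu> \<subseteq> \<Union>F"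
  proof
    fix x assume "x \<in> - msupp \<mu>"
    then obtain C where C: "closed C" "emeasure \<mu> C = emeasure \<mu> UNIV" "x \<notin> C"
      by (auto simp: msupp_def)
    have "emeasure \<mu> (- C) = 0"
      using emeasure_compl[of C \<mu>] C by (simp add: Compl_eq_Diff_UNIV)
    with C show "x \<in> \<Union>F" by (auto simp: F_def intro!: bexI[of _ "- C"])
  qed
  moreover have "(\<Union>G\<in>F'. G) \<in> null_sets \<mu>"
    using F' by (intro null_sets_UN') (auto simp: F_def null_sets_def)
  ultimately show ?thesis
    using F'(3) by (intro AE_I'[of "\<Union>F'"]) auto
qed

lemma couplingsD:
  assumes "\<pi> \<in> couplings \<mu> \<nu>"
  shows "borel_prob \<pi>" "\<mu> = distr \<pi> borel fst" "\<nu> = distr \<pi> borel snd"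
  using assms by (auto simp: couplings_def)

lemma borel_prob_measurable_fst_snd:
  fixes \<pi> :: "('x::topological_space \<times> 'y::topological_space) measure"
  assumes "borel_prob \<pi>"
  shows "fst \<in> measurable \<pi> borel" "snd \<in> measurable \<pi> borel"
  using assms
  by (auto simp: borel_prob_def cong: measurable_cong_sets
      intro!: borel_measurable_continuous_onI continuous_intros)

text \<open>A closed set \<open>C\<close> of full measure for \<mu> yields the closed cylinder
  \<open>C \<times> UNIV\<close> of full measure for \<pi>, which contains the support of
  \<pi>.\<close>

lemma fst_msupp_coupling_subset:
  assumes "\<pi> \<in> couplings \<mu> \<nu>"
  shows "fst ` msupp \<pi> \<subseteq> msupp \<mu>"
proof safe
  fix x y assume xy: "(x, y) \<in> msupp \<pi>"
  note \<pi> = couplingsD[OF assms]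
  have "x \<in> C" if C: "closed C" "emeasure \<mu> C = emeasure \<mu> (space \<mu>)" for C
  proof -
    have "emeasure \<pi> (C \<times> UNIV) = emeasure \<mu> C"
      using C(1) \<pi> borel_prob_measurable_fst_snd[OF \<pi>(1)]
      by (simp add: emeasure_distr borel_prob_space) (auto intro!: arg_cong[where f = "emeasure \<pi>"])
    also have "\<dots> = emeasure \<pi> (space \<pi>)"
      using C(2) \<pi> borel_prob_measurable_fst_snd[OF \<pi>(1)]
      by (simp add: emeasure_distr borel_prob_space)
    finally have "msupp \<pi> \<subseteq> C \<times> UNIV"
      using C(1) unfolding msupp_def by (intro Inter_lower) (auto intro: closed_Times)
    with xy show ?thesis by auto
  qed
  then show "fst (x, y) \<in> msupp \<mu>" by (auto simp: msupp_def)
qed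

text \<open>An open set that misses the projection is null for \<mu>, as \<pi> is concentrated on
  its support. The projection need not be closed, so density is what remains of equality with the
  support of \<mu>.\<close>

lemma fst_msupp_coupling_dense:
  fixes \<pi> :: "('x::second_countable_topology \<times> 'y::second_countable_topology) measure"
  assumes "\<pi> \<in> couplings \<mu> \<nu>" "borel_prob \<mu>" "open G" "x \<in> G" "x \<in> msupp \<mu>"
  shows "\<exists>z \<in> fst ` msupp \<pi>. z \<in> G"
proof (rule ccontr)
  note \<pi> = couplingsD[OF assms(1)]
  assume none: "\<not> ?thesis"
  have "AE z in \<pi>. fst z \<notin> G"
    using AE_in_msupp[OF \<pi>(1)] by eventually_elim (use none in auto)
  then have "AE z in \<mu>. z \<notin> G"
    unfolding \<pi>(2) using assms(3) borel_prob_measurable_fst_snd(1)[OF \<pi>(1)]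
    by (subst AE_distr_iff) (auto simp: Collect_neg_eq)
  then have "emeasure \<mu> G = 0"
    using assms(2,3) by (subst (asm) AE_iff_measurable[where N = G]) (auto simp: borel_prob_space borel_prob_def)
  then show False using emeasure_open_msupp_nonzero[OF assms(2-5)] by simp
qed

section \<open>Upper semicontinuous dual pairs\<close>

text \<open>Closed superlevel sets express upper semicontinuity, which passes to infima. Where
  \<open>g y\<close> is infinite, the function under the infimum is constant in
  \<open>x\<close>.\<close>

lemma closed_superlevel_c_transform:
  fixes c :: "'x::topological_space \<Rightarrow> 'y \<Rightarrow> real"
  assumes "\<And>y. continuous_on UNIV (\<lambda>x. c x y)"
  shows "closed {x. a \<le> c_transform c g x}"
proof -
  have "closed {x. a \<le> ereal (c x y) - g y}" for y
  proof (cases "g y")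
    case (real r)
    have "closed {x. a \<le> ereal (c x y - r)}"
      by (intro closed_Collect_le continuous_intros assms)
    then show ?thesis by (simp add: real)
  qed auto
  then have "closed (\<Inter>y. {x. a \<le> ereal (c x y) - g y})" by (intro closed_INT) auto
  also have "(\<Inter>y. {x. a \<le> ereal (c x y) - g y}) = {x. a \<le> c_transform c g x}"
    by (auto simp: c_transform_def le_INF_iff)
  finally show ?thesis .
qed

lemma closed_superlevel_borel_measurable:
  fixes f :: "'x::topological_space \<Rightarrow> ereal"
  assumes "\<And>a. closed {x. a \<le> f x}"
  shows "f \<in> borel_measurable borel"
  by (rule borel_measurableI_ge) (use assms in auto)

text \<open>Turns a strict inequality for a sum into separate strict bounds, which define an open
  box in the product. Two real summands receive one third of the gap each, and the last third keeps
  the inequality strict.\<close>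

lemma ereal_split_sum_less:
  fixes a b :: ereal
  assumes "a \<noteq> \<infinity>" "b \<noteq> \<infinity>" "a + b < ereal r"
  obtains \<alpha> \<beta> :: real where "a < ereal \<alpha>" "b < ereal \<beta>" "\<alpha> + \<beta> < r"
proof (cases a; cases b)
  fix s t assume st: "a = ereal s" "b = ereal t"
  with assms have "s + t < r" by simp
  then show ?thesis
    using st by (intro that[of "s + (r - s - t) / 3" "t + (r - s - t) / 3"]) (auto simp: field_simps)
next
  fix s assume "a = ereal s" "b = -\<infinity>"
  then show ?thesis by (intro that[of "s + 1" "r - s - 2"]) auto
next
  fix t assume "b = ereal t" "a = -\<infinity>"
  then show ?thesis by (intro that[of "r - t - 2" "t + 1"]) auto
next
  assume "b = -\<infinity>" "a = -\<infinity>"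
  then show ?thesis by (intro that[of "r - 1" 0]) auto
qed (use assms in auto)

text \<open>If the inequality is strict at a point, then semicontinuity of \<open>f\<close> and
  \<open>g\<close> and continuity of \<open>c\<close> make it strict on an open neighbourhood. That
  neighbourhood is null for \<pi> and hence misses the support.\<close>

lemma msupp_subset_contact_set:
  fixes f :: "'x::topological_space \<Rightarrow> ereal" and g :: "'y::topological_space \<Rightarrow> ereal"
  assumes \<pi>: "borel_prob \<pi>"
    and f: "\<And>x. f x \<noteq> \<infinity>" "\<And>a. closed {x. a \<le> f x}"
    and g: "\<And>y. g y \<noteq> \<infinity>" "\<And>a. closed {y. a \<le> g y}"
    and c: "continuous_on UNIV (\<lambda>(x, y). c x y)"
    and le: "\<And>x y. f x + g y \<le> ereal (c x y)"
    and ae: "AE (x, y) in \<pi>. f x + g y = ereal (c x y)"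
    and xy: "(x, y) \<in> msupp \<pi>"
  shows "f x + g y = ereal (c x y)"
proof (rule ccontr)
  assume "\<not> ?thesis"
  with le[of x y] have "f x + g y < ereal (c x y)" by auto
  then obtain \<alpha> \<beta> where ab: "f x < ereal \<alpha>" "g y < ereal \<beta>" "\<alpha> + \<beta> < c x y"
    using ereal_split_sum_less f(1) g(1) by blast
  define G where "G = ({x. f x < ereal \<alpha>} \<times> {y. g y < ereal \<beta>}) \<inter> {z. \<alpha> + \<beta> < (case z of (x, y) \<Rightarrow> c x y)}"
  have "open {x. f x < ereal \<alpha>}" "open {y. g y < ereal \<beta>}"
    using f(2)[of "ereal \<alpha>"] g(2)[of "ereal \<beta>"]
    by (auto simp: closed_def Compl_eq not_le)
  moreover have "open {z. \<alpha> + \<beta> < (case z of (x, y) \<Rightarrow> c x y)}"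
    by (intro open_Collect_less continuous_intros c)
  ultimately have G: "open G" unfolding G_def by (intro open_Int open_Times)
  have "AE z in \<pi>. z \<notin> G"
    using ae
  proof eventually_elim
    case (elim z)
    obtain x' y' where z: "z = (x', y')" by (cases z)
    show ?case
    proof
      assume "z \<in> G"
      then have "f x' < ereal \<alpha>" "g y' < ereal \<beta>" "\<alpha> + \<beta> < c x' y'" by (auto simp: G_def z)
      with elim show False
        using f(1)[of x'] g(1)[of y'] by (cases "f x'"; cases "g y'") (auto simp: z)
    qed
  qed
  then have "emeasure \<pi> G = 0"
    using \<pi> G by (subst (asm) AE_iff_measurable[where N = G]) (auto simp: borel_prob_space borel_prob_def)
  moreover have "(x, y) \<in> G" using ab by (simp add: G_def)
  ultimately show False using emeasure_open_msupp_nonzero[OF \<pi> G _ xy] by simp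
qed

section \<open>Complementary slackness\<close>

lemma AE_marginals:
  assumes "\<pi> \<in> couplings \<mu> \<nu>"
  shows "(AE x in \<mu>. P x) \<Longrightarrow> AE z in \<pi>. P (fst z)" "(AE y in \<nu>. Q y) \<Longrightarrow> AE z in \<pi>. Q (snd z)"
  using AE_distrD[of fst \<pi> borel P] AE_distrD[of snd \<pi> borel Q]
    couplingsD[OF assms] borel_prob_measurable_fst_snd[of \<pi>] by auto

text \<open>The defect of the dual inequality is nonnegative, and formally its integral depends only
  on the cost and the marginals, so it vanishes for one plan if it does for the other. Almost sure
  finiteness of \<open>f\<close> and \<open>g\<close> concerns the marginals alone and is
  transferred first.\<close>

lemma dual_equality_transfer:
  fixes f :: "'x::second_countable_topology \<Rightarrow> ereal" and g :: "'y::second_countable_topology \<Rightarrow> ereal"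
    and \<pi> \<pi>' :: "('x \<times> 'y) measure"
  assumes \<pi>: "\<pi> \<in> couplings \<mu> \<nu>" and \<pi>': "\<pi>' \<in> couplings \<mu> \<nu>"
    and f: "f \<in> borel_measurable borel" and g: "g \<in> borel_measurable borel"
    and c: "(\<lambda>(x, y). c x y) \<in> borel_measurable borel" "\<And>x y. c x y \<ge> 0"
    and le: "\<And>x y. f x + g y \<le> ereal (c x y)"
    and cost: "plan_cost c \<pi> = plan_cost c \<pi>'" "plan_cost c \<pi>' < \<infinity>"
    and eq: "AE (x, y) in \<pi>'. f x + g y = ereal (c x y)"
  shows "AE (x, y) in \<pi>. f x + g y = ereal (c x y)"
proof -
  note [measurable] = f g c(1)
  have bp: "borel_prob \<pi>" "borel_prob \<pi>'" using \<pi> \<pi>' couplingsD(1) by blast+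
  note fs [measurable] = borel_prob_measurable_fst_snd[OF bp(1)] borel_prob_measurable_fst_snd[OF bp(2)]
  have \<mu>: "\<mu> = distr \<pi> borel fst" "\<mu> = distr \<pi>' borel fst"
    and \<nu>: "\<nu> = distr \<pi> borel snd" "\<nu> = distr \<pi>' borel snd"
    using couplingsD[OF \<pi>] couplingsD[OF \<pi>'] by auto
  have sets: "sets \<pi> = sets borel" "sets \<pi>' = sets borel" using bp by (auto simp: borel_prob_def)
  have c\<pi> [measurable]: "(\<lambda>z. c (fst z) (snd z)) \<in> borel_measurable \<pi>" "(\<lambda>z. c (fst z) (snd z)) \<in> borel_measurable \<pi>'"
    using c(1)
    unfolding measurable_cong_sets[OF sets(1) refl] measurable_cong_sets[OF sets(2) refl] case_prod_beta
    by simp_all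
  interpret P: prob_space \<pi> using bp(1) by (simp add: borel_prob_def)
  interpret P': prob_space \<pi>' using bp(2) by (simp add: borel_prob_def)
  \<comment> \<open>\<open>real_of_ereal\<close> sends infinite values to 0. This is harmless,
    because \<open>f\<close> and \<open>g\<close> turn out to be finite almost everywhere under the
    marginals.\<close>
  define a where "a = real_of_ereal \<circ> f"
  define b where "b = real_of_ereal \<circ> g"
  have [measurable]: "a \<in> borel_measurable borel" "b \<in> borel_measurable borel"
    unfolding a_def b_def comp_def by measurable
  have "AE z in \<pi>'. \<bar>f (fst z)\<bar> \<noteq> \<infinity>" "AE z in \<pi>'. \<bar>g (snd z)\<bar> \<noteq> \<infinity>"
    using eq by (eventually_elim, case_tac z, case_tac "f (fst z)"; case_tac "g (snd z)"; force)+
  then have "AE x in \<mu>. \<bar>f x\<bar> \<noteq> \<infinity>" "AE y in \<nu>. \<bar>g y\<bar> \<noteq> \<infinity>"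
    unfolding \<mu>(2) \<nu>(2) by (subst AE_distr_iff; simp)+
  then have fin: "AE x in \<mu>. f x = ereal (a x)" "AE y in \<nu>. g y = ereal (b y)"
    by (auto elim!: eventually_mono simp: a_def b_def ereal_real)
  have fin\<pi>: "AE z in \<pi>. f (fst z) = ereal (a (fst z)) \<and> g (snd z) = ereal (b (snd z))"
    using AE_marginals(1)[OF \<pi> fin(1)] AE_marginals(2)[OF \<pi> fin(2)] by eventually_elim auto
  have fin\<pi>': "AE z in \<pi>'. f (fst z) = ereal (a (fst z)) \<and> g (snd z) = ereal (b (snd z))"
    using AE_marginals(1)[OF \<pi>' fin(1)] AE_marginals(2)[OF \<pi>' fin(2)] by eventually_elim auto
  \<comment> \<open>\<open>a\<close> and \<open>b\<close> need not be integrable separately. After truncation they are, and then the integral of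
    their sum depends on the marginals only.\<close>
  define T where "T n t = max (- real n) (min (real n) t)" for n t
  \<comment> \<open>The second bound provides the dominating function \<open>C\<close> under
    \<open>\<pi>'\<close>, where the sum equals \<open>C\<close>. The third makes
    \<open>C - S n\<close> nonnegative under \<pi>, where the sum is only known to be at most
    \<open>C\<close>.\<close>
  have T: "\<bar>T n t\<bar> \<le> real n" "\<bar>T n s + T n t\<bar> \<le> \<bar>s + t\<bar>" "T n s + T n t \<le> max 0 (s + t)" for n s t
    by (auto simp: T_def max_def min_def)
  have T_lim: "(\<lambda>n. T n t) \<longlonglongrightarrow> t" for t
  proof (rule tendsto_eventually)
    obtain m where "\<bar>t\<bar> \<le> real m" using real_arch_simple by blast
    then show "\<forall>\<^sub>F n in sequentially. T n t = t"
      by (intro eventually_sequentiallyI[of m]) (auto simp: T_def max_def min_def)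
  qed
  have [measurable]: "T n \<in> borel_measurable borel" for n
    unfolding T_def[abs_def] by measurable
  define S where "S n z = T n (a (fst z)) + T n (b (snd z))" for n z
  define C where "C z = c (fst z) (snd z)" for z
  have [measurable]: "S n \<in> borel_measurable \<pi>" "S n \<in> borel_measurable \<pi>'" "C \<in> borel_measurable \<pi>" "C \<in> borel_measurable \<pi>'" for n
    unfolding S_def[abs_def] C_def[abs_def] by measurable
  have costC: "plan_cost c \<rho> = (\<integral>\<^sup>+z. ennreal (C z) \<partial>\<rho>)" for \<rho>
    by (simp add: plan_cost_def C_def case_prod_unfold)
  have C_int: "integrable \<pi>' C" "integrable \<pi> C"
    using cost unfolding costC by (intro integrableI_nonneg; simp add: C_def c(2))+
  have C_eq: "(\<integral>z. C z \<partial>\<pi>) = (\<integral>z. C z \<partial>\<pi>')"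
    using cost(1) unfolding costC by (simp add: integral_eq_nn_integral C_def c(2))
  have T_int: "integrable \<pi> (\<lambda>z. T n (a (fst z)))" "integrable \<pi> (\<lambda>z. T n (b (snd z)))"
    "integrable \<pi>' (\<lambda>z. T n (a (fst z)))" "integrable \<pi>' (\<lambda>z. T n (b (snd z)))" for n
    using T(1) by (auto intro!: P.integrable_const_bound[of _ "real n"] P'.integrable_const_bound[of _ "real n"])
  have S_int: "integrable \<pi> (S n)" "integrable \<pi>' (S n)" for n
    unfolding S_def[abs_def] by (intro Bochner_Integration.integrable_add T_int)+
  have marg: "(\<integral>z. T n (a (fst z)) \<partial>\<pi>) = (\<integral>z. T n (a (fst z)) \<partial>\<pi>')"
    "(\<integral>z. T n (b (snd z)) \<partial>\<pi>) = (\<integral>z. T n (b (snd z)) \<partial>\<pi>')" for n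
  proof -
    have "(\<integral>x. T n (a x) \<partial>distr \<pi> borel fst) = (\<integral>x. T n (a x) \<partial>distr \<pi>' borel fst)"
      "(\<integral>y. T n (b y) \<partial>distr \<pi> borel snd) = (\<integral>y. T n (b y) \<partial>distr \<pi>' borel snd)"
      using \<mu> \<nu> by simp_all
    then show "(\<integral>z. T n (a (fst z)) \<partial>\<pi>) = (\<integral>z. T n (a (fst z)) \<partial>\<pi>')"
      "(\<integral>z. T n (b (snd z)) \<partial>\<pi>) = (\<integral>z. T n (b (snd z)) \<partial>\<pi>')"
      by (simp_all add: integral_distr)
  qed
  have S_eq: "(\<integral>z. S n z \<partial>\<pi>) = (\<integral>z. S n z \<partial>\<pi>')" for n
    unfolding S_def by (simp add: Bochner_Integration.integral_add T_int marg)
  have S_lim: "(\<lambda>n. S n z) \<longlonglongrightarrow> a (fst z) + b (snd z)" for z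
    unfolding S_def by (intro tendsto_add T_lim)
  have eq': "AE z in \<pi>'. a (fst z) + b (snd z) = C z"
    using eq fin\<pi>' by eventually_elim (auto simp: C_def)
  have "(\<lambda>n. \<integral>z. S n z \<partial>\<pi>') \<longlonglongrightarrow> (\<integral>z. C z \<partial>\<pi>')"
  proof (rule integral_dominated_convergence[OF _ _ C_int(1)])
    show "AE z in \<pi>'. (\<lambda>n. S n z) \<longlonglongrightarrow> C z"
      using eq' by eventually_elim (use S_lim in metis)
    show "AE z in \<pi>'. norm (S n z) \<le> C z" for n
      using eq' by eventually_elim
        (use T(2) c(2) in \<open>auto simp: S_def C_def intro!: order_trans[OF T(2)]\<close>)
  qed auto
  then have lim: "(\<lambda>n. (\<integral>z. C z \<partial>\<pi>) - (\<integral>z. S n z \<partial>\<pi>)) \<longlonglongrightarrow> 0"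
    unfolding S_eq C_eq by (intro tendsto_eq_intros) auto
  have le': "AE z in \<pi>. a (fst z) + b (snd z) \<le> C z"
    using fin\<pi>
  proof eventually_elim
    case (elim z)
    then show ?case using le[of "fst z" "snd z"] by (simp add: C_def)
  qed
  have nn_eq: "(\<integral>\<^sup>+z. ennreal (C z - S n z) \<partial>\<pi>) = ennreal ((\<integral>z. C z \<partial>\<pi>) - (\<integral>z. S n z \<partial>\<pi>))" for n
  proof -
    have "AE z in \<pi>. 0 \<le> C z - S n z"
      using le'
    proof eventually_elim
      case (elim z)
      then show ?case
        using T(3)[of n "a (fst z)" "b (snd z)"] c(2)[of "fst z" "snd z"] by (auto simp: S_def C_def)
    qed
    then show ?thesis
      using C_int S_int by (subst nn_integral_eq_integral) auto
  qed
  \<comment> \<open>Under \<pi> no integrable bound for the absolute value of the sum is at hand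
    yet, so Fatou's lemma for the nonnegative defects takes the place of dominated
    convergence.\<close>
  have "(\<integral>\<^sup>+z. ennreal (C z - (a (fst z) + b (snd z))) \<partial>\<pi>)
      = (\<integral>\<^sup>+z. liminf (\<lambda>n. ennreal (C z - S n z)) \<partial>\<pi>)"
    by (intro nn_integral_cong lim_imp_Liminf[symmetric] tendsto_ennrealI tendsto_intros S_lim) auto
  also have "\<dots> \<le> liminf (\<lambda>n. \<integral>\<^sup>+z. ennreal (C z - S n z) \<partial>\<pi>)"
    by (rule nn_integral_liminf) measurable
  also have "\<dots> = ennreal 0"
    unfolding nn_eq by (intro lim_imp_Liminf tendsto_ennrealI lim) auto
  finally have "(\<integral>\<^sup>+z. ennreal (C z - (a (fst z) + b (snd z))) \<partial>\<pi>) = 0" by simp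
  then have "AE z in \<pi>. ennreal (C z - (a (fst z) + b (snd z))) = 0"
    by (subst (asm) nn_integral_0_iff_AE) auto
  then have "AE z in \<pi>. a (fst z) + b (snd z) = C z"
    using le' by eventually_elim (auto simp: ennreal_eq_0_iff)
  then show ?thesis
    using fin\<pi> by eventually_elim (auto simp: C_def)
qed

text \<open>The positive part of \<open>f x + g y\<close> is at most the cost, so its integral
  \<open>p\<close> is at most the finite total cost \<open>t\<close>. Then \<open>t = p - n\<close>
  with \<open>n\<close> nonnegative forces \<open>n = 0\<close> and \<open>p = t\<close>: the sum is
  nonnegative and equals the cost almost everywhere.\<close>

lemma kantorovich_potential_AE_contact:
  fixes f :: "'x \<Rightarrow> ereal" and g :: "'y \<Rightarrow> ereal"
  assumes h [measurable]: "(\<lambda>(x, y). f x + g y) \<in> borel_measurable \<pi>"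
    and c [measurable]: "(\<lambda>(x, y). c x y) \<in> borel_measurable \<pi>" and c0: "\<And>x y. c x y \<ge> 0"
    and le: "\<And>x y. f x + g y \<le> ereal (c x y)"
    and fin: "plan_cost c \<pi> < \<infinity>"
    and eq: "enn2ereal (plan_cost c \<pi>) = ereal_integral \<pi> (\<lambda>(x, y). f x + g y)"
  shows "AE (x, y) in \<pi>. f x + g y = ereal (c x y)"
proof -
  define H where "H = (\<lambda>(x, y). f x + g y)"
  define C where "C = (\<lambda>(x, y). ennreal (c x y))"
  have [measurable]: "H \<in> borel_measurable \<pi>" "C \<in> borel_measurable \<pi>"
    using h c unfolding H_def C_def case_prod_beta by measurable
  have HC: "e2ennreal (H z) \<le> C z" for z
    using e2ennreal_mono[OF le] by (cases z) (auto simp: H_def C_def e2ennreal_ereal)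
  define p where "p = (\<integral>\<^sup>+z. e2ennreal (H z) \<partial>\<pi>)"
  define n where "n = (\<integral>\<^sup>+z. e2ennreal (- H z) \<partial>\<pi>)"
  define t where "t = (\<integral>\<^sup>+z. C z \<partial>\<pi>)"
  have t: "t = plan_cost c \<pi>" by (simp add: t_def C_def plan_cost_def)
  have pt: "p \<le> t" unfolding p_def t_def by (intro nn_integral_mono HC)
  have "t < \<infinity>" using fin t by simp
  have E: "enn2ereal t = enn2ereal p - enn2ereal n"
    using eq unfolding ereal_integral_def t p_def n_def H_def .
  have "n = 0 \<and> p = t"
    using E pt \<open>t < \<infinity>\<close>
    by (cases t; cases p; cases n) (auto simp: enn2ereal_ennreal ennreal_eq_0_iff top_ennreal.rep_eq top_ereal_def infinity_ennreal_def)
  then have n0: "n = 0" and p: "p = t" by auto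
  have neg: "AE z in \<pi>. e2ennreal (- H z) = 0"
    using n0 unfolding n_def by (subst (asm) nn_integral_0_iff_AE) auto
  have "(\<integral>\<^sup>+z. C z - e2ennreal (H z) \<partial>\<pi>) = t - p"
    unfolding t_def p_def
    by (intro nn_integral_diff) (use HC pt p \<open>t < \<infinity>\<close> in \<open>auto simp: p_def\<close>)
  also have "\<dots> = 0" using p \<open>t < \<infinity>\<close> by simp
  finally have "AE z in \<pi>. C z - e2ennreal (H z) = 0"
    by (subst (asm) nn_integral_0_iff_AE) auto
  with neg show ?thesis
  proof eventually_elim
    case (elim z)
    obtain x y where z: "z = (x, y)" by (cases z)
    have "\<not> H z < 0" using elim(1)
      by (cases "H z") (auto simp: e2ennreal_ereal ennreal_eq_0_iff)
    moreover have "H z \<le> ereal (c x y)" "C z = ennreal (c x y)"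
      using le by (simp_all add: H_def C_def z)
    ultimately have "H z = ereal (c x y)"
      using elim HC[of z] c0[of x y]
      by (cases "H z") (auto simp: e2ennreal_ereal diff_eq_0_iff_ennreal)
    then show ?case by (simp add: z H_def)
  qed
qed

text \<open>What the geometric arguments retain of a potential and its transform. Equality is
  required at every point of the support, not just almost everywhere, because contact is used
  pointwise.\<close>

definition tight_dual_pair ::
  "('x::topological_space \<Rightarrow> 'y::topological_space \<Rightarrow> real) \<Rightarrow> ('x \<times> 'y) measure \<Rightarrow>
   ('x \<Rightarrow> ereal) \<Rightarrow> ('y \<Rightarrow> ereal) \<Rightarrow> bool" where
  "tight_dual_pair c \<pi> f g \<longleftrightarrow>
     (\<forall>a. closed {x. a \<le> f x}) \<and>
     (\<forall>x y. f x + g y \<le> ereal (c x y)) \<and>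
     (\<forall>(x, y)\<in>msupp \<pi>. f x + g y = ereal (c x y))"

lemma tight_dual_pairD:
  assumes "tight_dual_pair c \<pi> f g"
  shows "closed {x. a \<le> f x}" "f x + g y \<le> ereal (c x y)"
    "(x, y) \<in> msupp \<pi> \<Longrightarrow> f x + g y = ereal (c x y)"
  using assms by (auto simp: tight_dual_pair_def)

text \<open>The optimal plan that certifies \<open>f\<close> may differ from \<pi>. Equality is
  first obtained almost everywhere for that plan, then transferred to \<pi>, and finally extended to
  the whole support by semicontinuity.\<close>

lemma kantorovich_potential_tight:
  fixes c :: "'x::second_countable_topology \<Rightarrow> 'y::second_countable_topology \<Rightarrow> real"
  assumes c: "continuous_on UNIV (\<lambda>(x, y). c x y)" "\<And>x y. c x y \<ge> 0"
    and fin: "transport_cost c \<mu> \<nu> < \<infinity>" and opt: "optimal_plan c \<mu> \<nu> \<pi>"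
    and f: "f \<in> kantorovich_potentials c \<mu> \<nu>"
  shows "tight_dual_pair c \<pi> f (c_transform (\<lambda>y x. c x y) f)"
proof -
  define g where "g = c_transform (\<lambda>y x. c x y) f"
  obtain \<pi>' g0 x0 where f_fin: "\<And>x. f x \<noteq> \<infinity>" and f_eq: "f = c_transform c g0" and x0: "f x0 \<noteq> -\<infinity>"
    and opt': "optimal_plan c \<mu> \<nu> \<pi>'"
    and eq: "enn2ereal (transport_cost c \<mu> \<nu>) = ereal_integral \<pi>' (\<lambda>(x, y). f x + g y)"
    using f by (auto simp: kantorovich_potentials_def c_concave_def g_def)
  have g_le: "g y \<le> ereal (c x y) - f x" for x y
    unfolding g_def c_transform_def by (rule INF_lower) simp
  have g_fin: "g y \<noteq> \<infinity>" for y
    using g_le[of y x0] x0 f_fin[of x0] by (cases "f x0") auto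
  have le: "f x + g y \<le> ereal (c x y)" for x y
    using g_le[of y x] f_fin[of x] g_fin[of y] by (cases "f x"; cases "g y") auto
  have sections: "continuous_on UNIV (\<lambda>x. c x y)" "continuous_on UNIV (\<lambda>y. c x y)" for x y
  proof -
    have "continuous_on UNIV (\<lambda>x. (x, y))" "continuous_on UNIV (\<lambda>y. (x, y))"
      by (intro continuous_intros)+
    then show "continuous_on UNIV (\<lambda>x. c x y)" "continuous_on UNIV (\<lambda>y. c x y)"
      using continuous_on_compose2[OF c(1)] by fastforce+
  qed
  have f_closed: "closed {x. a \<le> f x}" for a
    unfolding f_eq by (intro closed_superlevel_c_transform sections)
  have g_closed: "closed {y. a \<le> g y}" for a
    unfolding g_def by (intro closed_superlevel_c_transform sections)
  note meas = closed_superlevel_borel_measurable[OF f_closed] closed_superlevel_borel_measurable[OF g_closed]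
    borel_measurable_continuous_onI[OF c(1)]
  have \<pi>: "\<pi> \<in> couplings \<mu> \<nu>" "\<pi>' \<in> couplings \<mu> \<nu>"
    and cost: "plan_cost c \<pi> = transport_cost c \<mu> \<nu>" "plan_cost c \<pi>' = transport_cost c \<mu> \<nu>"
    using opt opt' by (auto simp: optimal_plan_def)
  note bp = couplingsD(1)[OF \<pi>(1)] couplingsD(1)[OF \<pi>(2)]
  have sets: "sets \<pi>' = sets borel" using bp(2) by (simp add: borel_prob_def)
  have "AE (x, y) in \<pi>'. f x + g y = ereal (c x y)"
  proof (rule kantorovich_potential_AE_contact)
    note [measurable] = meas(1,2) borel_prob_measurable_fst_snd[OF bp(2)]
    show "(\<lambda>(x, y). f x + g y) \<in> borel_measurable \<pi>'"
      unfolding case_prod_beta by measurable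
    show "(\<lambda>(x, y). c x y) \<in> borel_measurable \<pi>'"
      using meas(3) by (simp only: measurable_cong_sets[OF sets refl])
  qed (use c(2) le fin eq cost in auto)
  then have "AE (x, y) in \<pi>. f x + g y = ereal (c x y)"
    by (rule dual_equality_transfer[OF \<pi> meas(1,2,3) c(2) le, rotated 2]) (use cost fin in auto)
  then have "f x + g y = ereal (c x y)" if "(x, y) \<in> msupp \<pi>" for x y
    using msupp_subset_contact_set[OF bp(1) f_fin f_closed g_fin g_closed c(1) le _ that] by blast
  then show ?thesis
    unfolding tight_dual_pair_def g_def[symmetric] using f_closed le by blast
qed

text \<open>The estimate \<open>est\<close> bounds \<open>f\<close> from above by its values on
  \<open>D\<close>. The matching lower bound on \<open>S\<close> comes from upper semicontinuity: a
  value that is too small would persist at nearby points of \<open>D\<close> and contradict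
  \<open>est\<close> there.\<close>

lemma upper_semicontinuous_Lipschitz_from_dense:
  fixes f :: "'x::topological_space \<Rightarrow> ereal" and \<phi> :: "'x \<Rightarrow> 'e::metric_space"
  assumes W: "open W" "continuous_on W \<phi>" and L: "L \<ge> 0"
    and D: "D \<subseteq> S" "\<And>G x. open G \<Longrightarrow> x \<in> G \<Longrightarrow> x \<in> S \<Longrightarrow> \<exists>z\<in>D. z \<in> G"
    and usc: "\<And>a. closed {x. a \<le> f x}"
    and fin: "\<And>z. z \<in> D \<inter> W \<Longrightarrow> \<bar>f z\<bar> \<noteq> \<infinity>"
    and est: "\<And>x z. x \<in> W \<Longrightarrow> z \<in> D \<inter> W \<Longrightarrow> f x \<le> f z + ereal (L * dist (\<phi> x) (\<phi> z))"
  shows "x \<in> W \<inter> S \<Longrightarrow> \<bar>f x\<bar> \<noteq> \<infinity>"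
    and "x \<in> W \<inter> S \<Longrightarrow> y \<in> W \<inter> S \<Longrightarrow>
      \<bar>real_of_ereal (f x) - real_of_ereal (f y)\<bar> \<le> L * dist (\<phi> x) (\<phi> y)"
proof -
  have near: "open (W \<inter> {w. L * dist (\<phi> w) p < r})" for p r
  proof -
    have "open (W \<inter> (\<lambda>w. L * dist (\<phi> w) p) -` {..<r})"
      by (intro continuous_open_preimage W continuous_intros open_lessThan)
    then show ?thesis by (simp add: vimage_def lessThan_def)
  qed
  have lower: "f z \<le> f x + ereal (L * dist (\<phi> x) (\<phi> z))" if x: "x \<in> W \<inter> S" and z: "z \<in> D \<inter> W" for x z
  proof (rule ccontr)
    assume neg: "\<not> ?thesis"
    obtain r where r: "f z = ereal r" using fin[OF z] by auto
    define d where "d = L * dist (\<phi> x) (\<phi> z)"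
    have "f x < ereal (r - d)"
      using neg r by (cases "f x") (auto simp: d_def)
    then obtain s where "f x < ereal s" "ereal s < ereal (r - d)"
      using ereal_dense2 by blast
    then have s: "f x < ereal s" "s < r - d" by simp_all
    \<comment> \<open>On \<open>G\<close> the value of \<open>f\<close> stays below \<open>s\<close>
      and the Lipschitz error below \<open>r - s\<close>, so a point of \<open>D\<close> in
      \<open>G\<close> would give \<open>f z < r\<close>.\<close>
    define G where "G = {w. f w < ereal s} \<inter> (W \<inter> {w. L * dist (\<phi> w) (\<phi> z) < r - s})"
    have "open {w. f w < ereal s}"
      using usc[of "ereal s"] by (auto simp: closed_def Compl_eq not_le)
    then have "open G" unfolding G_def by (intro open_Int near)
    moreover have "x \<in> G" using x s by (auto simp: G_def d_def)
    ultimately obtain z' where z': "z' \<in> D" "z' \<in> G" using D(2) x by blast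
    then have "f z \<le> f z' + ereal (L * dist (\<phi> z) (\<phi> z'))"
      using z by (intro est) (auto simp: G_def)
    then show False
      using z' r by (cases "f z'") (auto simp: G_def dist_commute)
  qed
  have fin_S: "\<bar>f x\<bar> \<noteq> \<infinity>" if x: "x \<in> W \<inter> S" for x
  proof -
    obtain z where z: "z \<in> D \<inter> W" using D(2)[OF W(1)] x by blast
    show ?thesis
      using fin[OF z] lower[OF x z] est[of x z] x z by (cases "f x"; cases "f z") auto
  qed
  then show "x \<in> W \<inter> S \<Longrightarrow> \<bar>f x\<bar> \<noteq> \<infinity>" .
  define F where "F = real_of_ereal \<circ> f"
  have F: "f x = ereal (F x)" if "x \<in> W \<inter> S" for x
    using fin_S[OF that] by (simp add: F_def ereal_real)
  have half: "F x - F y \<le> L * dist (\<phi> x) (\<phi> y)" if x: "x \<in> W \<inter> S" and y: "y \<in> W \<inter> S" for x y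
  proof (rule field_le_epsilon)
    fix e :: real assume e: "e > 0"
    \<comment> \<open>The comparison of \<open>x\<close> and \<open>y\<close> passes through a point
      of \<open>D\<close> near \<open>x\<close>; the distance from that point to \<open>x\<close>
      enters twice, hence \<open>e / 2\<close>.\<close>
    obtain z where z: "z \<in> D" "z \<in> W" "L * dist (\<phi> z) (\<phi> x) < e / 2"
      using D(2)[OF near[of "\<phi> x" "e / 2"], of x] x e by fastforce
    then have zS: "z \<in> W \<inter> S" using D(1) by auto
    have "F x \<le> F z + L * dist (\<phi> x) (\<phi> z)" "F z \<le> F y + L * dist (\<phi> y) (\<phi> z)"
      using est[of x z] lower[of y z] x y z F[OF x] F[OF y] F[OF zS] by auto
    moreover have "L * dist (\<phi> y) (\<phi> z) \<le> L * dist (\<phi> x) (\<phi> y) + L * dist (\<phi> z) (\<phi> x)"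
      using mult_left_mono[OF dist_triangle[of "\<phi> y" "\<phi> z" "\<phi> x"] L]
      by (simp add: algebra_simps dist_commute)
    ultimately show "F x - F y \<le> L * dist (\<phi> x) (\<phi> y) + e"
      using z(3) by (simp add: dist_commute)
  qed
  show "x \<in> W \<inter> S \<Longrightarrow> y \<in> W \<inter> S \<Longrightarrow>
      \<bar>real_of_ereal (f x) - real_of_ereal (f y)\<bar> \<le> L * dist (\<phi> x) (\<phi> y)"
    using half[of x y] half[of y x] by (simp add: F_def dist_commute abs_le_iff)
qed

section \<open>Regularity of potentials\<close>

lemma chart_onD:
  assumes "chart_on V (U, \<phi>)"
  shows "open U" "openin (top_of_set V) (\<phi> ` U)" "homeomorphism U (\<phi> ` U) \<phi> (inv_into U \<phi>)"
    "continuous_on U \<phi>" "inj_on \<phi> U"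
proof -
  show U: "open U" "openin (top_of_set V) (\<phi> ` U)" "homeomorphism U (\<phi> ` U) \<phi> (inv_into U \<phi>)"
    using assms by (auto simp: chart_on_def)
  show "continuous_on U \<phi>" using U(3) by (rule homeomorphism_cont1)
  show "inj_on \<phi> U"
    by (rule inj_on_inverseI[where g = "inv_into U \<phi>"]) (rule homeomorphism_apply1[OF U(3)])
qed

lemma smooth_atlas_chartE:
  assumes "smooth_atlas V A"
  obtains U \<phi> where "(U, \<phi>) \<in> A" "chart_on V (U, \<phi>)" "x \<in> U"
proof -
  have "x \<in> (\<Union>(U, \<phi>)\<in>A. U)" using assms unfolding smooth_atlas_def by blast
  then obtain \<kappa> where \<kappa>: "\<kappa> \<in> A" "x \<in> fst \<kappa>" by (auto simp: case_prod_unfold)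
  moreover have "chart_on V \<kappa>" using assms \<kappa>(1) unfolding smooth_atlas_def by blast
  ultimately show ?thesis using that[of "fst \<kappa>" "snd \<kappa>"] by simp
qed

text \<open>Induced regularity gives each projected point \<open>z\<close> near \<open>x\<close> a
  partner \<open>y\<close> in one compact set \<open>K\<close>. Comparing equality at
  \<open>(z, y)\<close> with the inequality at \<open>(w, y)\<close> bounds \<open>f w - f z\<close>
  by \<open>c w y - c z y\<close>, with a Lipschitz constant uniform over \<open>K\<close>; density
  extends the bound to the support of \<mu>.\<close>

lemma tight_dual_pair_locally_Lipschitz:
  fixes c :: "'x::second_countable_topology \<Rightarrow> 'y::second_countable_topology \<Rightarrow> real"
    and A :: "('x, 'e::euclidean_space) chart set"
  assumes lip: "locally_Lipschitz_locally_uniformly A (\<lambda>y x. c x y)"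
    and \<mu>: "borel_prob \<mu>" and \<pi>: "\<pi> \<in> couplings \<mu> \<nu>"
    and tight: "tight_dual_pair c \<pi> f g"
    and chart: "(U, \<phi>) \<in> A" "chart_on V (U, \<phi>)" "x \<in> U"
    and x: "x \<in> msupp \<mu> - irregular_set \<mu> \<nu> \<pi>"
  obtains W L where "open W" "x \<in> W" "W \<subseteq> U" "L \<ge> 0"
    "\<And>z. z \<in> W \<inter> msupp \<mu> \<Longrightarrow> \<bar>f z\<bar> \<noteq> \<infinity>"
    "\<And>z w. z \<in> W \<inter> msupp \<mu> \<Longrightarrow> w \<in> W \<inter> msupp \<mu> \<Longrightarrow>
      \<bar>real_of_ereal (f z) - real_of_ereal (f w)\<bar> \<le> L * dist (\<phi> z) (\<phi> w)"
proof -
  obtain U' K where U': "x \<in> U'" "openin (top_of_set (msupp \<mu>)) U'" and K: "compact K"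
    and reg: "fst ` msupp \<pi> \<inter> U' = fst ` (msupp \<pi> \<inter> (U' \<times> K))"
    using x by (auto simp: irregular_set_def induces_regularity_at_def induces_regularity_on_def)
  obtain G where G: "open G" "U' = msupp \<mu> \<inter> G" using U'(2) by (auto simp: openin_open)
  obtain W0 L where W0: "open W0" "x \<in> W0" "W0 \<subseteq> U"
    and L: "\<And>y. y \<in> K \<Longrightarrow> L-lipschitz_on (\<phi> ` W0) ((\<lambda>x. c x y) \<circ> inv_into U \<phi>)"
  proof -
    have "locally_Lipschitz_uniformly A K (\<lambda>y x. c x y)"
      using lip K by (simp add: locally_Lipschitz_locally_uniformly_def)
    from bspec[OF this[unfolded locally_Lipschitz_uniformly_def] chart(1)] chart(3)
    obtain W L where "open W" "x \<in> W" "W \<subseteq> U"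
      "\<forall>y\<in>K. L-lipschitz_on (\<phi> ` W) ((\<lambda>x. c x y) \<circ> inv_into U \<phi>)"
      by auto
    then show ?thesis by (intro that[of W L]) blast+
  qed
  define W where "W = W0 \<inter> G"
  have W: "open W" "x \<in> W" "W \<subseteq> U" using W0 G U' by (auto simp: W_def)
  note D = fst_msupp_coupling_subset[OF \<pi>] fst_msupp_coupling_dense[OF \<pi> \<mu>]
  have contact: "\<exists>y\<in>K. (z, y) \<in> msupp \<pi>" if "z \<in> fst ` msupp \<pi> \<inter> W" for z
  proof -
    have "z \<in> fst ` msupp \<pi> \<inter> U'" using that D(1) G by (auto simp: W_def)
    then show ?thesis unfolding reg by auto
  qed
  have "x \<in> msupp \<mu>" using x by auto
  \<comment> \<open>This shows that \<open>K\<close> is nonempty, which is needed to read off that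
    \<open>L\<close> is nonnegative.\<close>
  then obtain z0 where "z0 \<in> fst ` msupp \<pi> \<inter> W" using D(2)[OF W(1,2)] by blast
  from contact[OF this] obtain y0 where "y0 \<in> K" by blast
  from lipschitz_on_nonneg[OF L[OF this]] have L0: "L \<ge> 0" .
  have fin: "\<bar>f z\<bar> \<noteq> \<infinity>" if z: "z \<in> fst ` msupp \<pi> \<inter> W" for z
  proof -
    obtain y where "(z, y) \<in> msupp \<pi>" using contact[OF z] by blast
    then have "f z + g y = ereal (c z y)" by (rule tight_dual_pairD[OF tight])
    then show ?thesis by (cases "f z"; cases "g y") auto
  qed
  have est: "f w \<le> f z + ereal (L * dist (\<phi> w) (\<phi> z))" if w: "w \<in> W" and z: "z \<in> fst ` msupp \<pi> \<inter> W" for w z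
  proof -
    obtain y where y: "y \<in> K" "(z, y) \<in> msupp \<pi>" using contact[OF z] by blast
    have fg: "f z + g y = ereal (c z y)" "f w + g y \<le> ereal (c w y)"
      by (rule tight_dual_pairD[OF tight] y)+
    have inv: "inv_into U \<phi> (\<phi> v) = v" if "v \<in> W" for v
      using that W(3) chart_onD(5)[OF chart(2)] by (auto intro!: inv_into_f_f)
    have "dist (c w y) (c z y) \<le> L * dist (\<phi> w) (\<phi> z)"
      using lipschitz_onD[OF L[OF y(1)], of "\<phi> w" "\<phi> z"] w z inv by (auto simp: W_def)
    then have "c w y \<le> c z y + L * dist (\<phi> w) (\<phi> z)" by (auto simp: dist_real_def)
    with fg show ?thesis by (cases "f z"; cases "g y"; cases "f w") auto
  qed
  have usc: "closed {x. a \<le> f x}" for a by (rule tight_dual_pairD[OF tight])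
  have cont: "continuous_on W \<phi>"
    by (rule continuous_on_subset[OF chart_onD(4)[OF chart(2)] W(3)])
  note extension = upper_semicontinuous_Lipschitz_from_dense[OF W(1) cont L0 D(1) _ usc]
  show ?thesis
  proof (rule that[OF W L0])
    show "\<bar>f z\<bar> \<noteq> \<infinity>" if "z \<in> W \<inter> msupp \<mu>" for z
      by (rule extension(1)[OF _ _ _ that]) (fact D(2) fin est)+
    show "\<bar>real_of_ereal (f z) - real_of_ereal (f w)\<bar> \<le> L * dist (\<phi> z) (\<phi> w)"
      if "z \<in> W \<inter> msupp \<mu>" "w \<in> W \<inter> msupp \<mu>" for z w
      by (rule extension(2)[OF _ _ _ that]) (fact D(2) fin est)+
  qed
qed

text \<open>Both pairs are tight on the support of the same plan, so at a projected point the same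
  \<open>y\<close> serves both, and \<open>c\<close> with \<open>y\<close> fixed is a common upper
  contact function. In a chart the Euclidean comparison then applies.\<close>

lemma tight_dual_pairs_difference_locally_constant:
  fixes V :: "'e::euclidean_space set"
    and c :: "'x::second_countable_topology \<Rightarrow> 'y::second_countable_topology \<Rightarrow> real"
    and A :: "('x, 'e) chart set"
  assumes V: "model_space V" and A: "smooth_atlas V A"
    and lip: "locally_Lipschitz_locally_uniformly A (\<lambda>y x. c x y)"
    and \<mu>: "borel_prob \<mu>" and \<pi>: "\<pi> \<in> couplings \<mu> \<nu>"
    and tight: "tight_dual_pair c \<pi> f g" "tight_dual_pair c \<pi> f' g'"
    and M: "open M" "M \<subseteq> msupp \<mu> - irregular_set \<mu> \<nu> \<pi>"
    and full: "full_lebesgue_measure_in_charts V A M (fst ` gradient_set A c \<pi>)"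
    and x: "x \<in> M"
  obtains W where "open W" "x \<in> W"
    "\<And>z. z \<in> W \<Longrightarrow> real_of_ereal (f z) - real_of_ereal (f' z) = real_of_ereal (f x) - real_of_ereal (f' x)"
proof -
  obtain U \<phi> where U: "(U, \<phi>) \<in> A" "x \<in> U" and chart: "chart_on V (U, \<phi>)"
    using smooth_atlas_chartE[OF A] by metis
  note ch = chart_onD[OF chart]
  define \<psi> where "\<psi> = inv_into U \<phi>"
  have \<psi>: "\<psi> (\<phi> z) = z" if "z \<in> U" for z
    using that ch(5) by (simp add: \<psi>_def)
  show ?thesis
  proof (cases "V = {0}")
    \<comment> \<open>In dimension zero the domain of a chart is a single point, which is therefore
      open.\<close>
    case True
    have "\<phi> ` U \<subseteq> {0}" using ch(2) True by (metis openin_imp_subset)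
    then have "z = x" if "z \<in> U" for z
      using that U(2) \<psi> by (metis image_subset_iff singletonD)
    then show ?thesis using that[OF ch(1) U(2)] by blast
  next
    case False
    then have "V = UNIV" using V by (simp add: model_space_def)
    then have open_image: "open (\<phi> ` U)" using ch(2) by simp
    have xr: "x \<in> msupp \<mu> - irregular_set \<mu> \<nu> \<pi>" using x M(2) by blast
    obtain W1 L1 where W1: "open W1" "x \<in> W1" "W1 \<subseteq> U" "L1 \<ge> 0"
      "\<And>z. z \<in> W1 \<inter> msupp \<mu> \<Longrightarrow> \<bar>f z\<bar> \<noteq> \<infinity>"
      "\<And>z w. z \<in> W1 \<inter> msupp \<mu> \<Longrightarrow> w \<in> W1 \<inter> msupp \<mu> \<Longrightarrow>
        \<bar>real_of_ereal (f z) - real_of_ereal (f w)\<bar> \<le> L1 * dist (\<phi> z) (\<phi> w)"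
      by (rule tight_dual_pair_locally_Lipschitz[OF lip \<mu> \<pi> tight(1) U(1) chart U(2) xr]) blast
    obtain W2 L2 where W2: "open W2" "x \<in> W2" "W2 \<subseteq> U" "L2 \<ge> 0"
      "\<And>z. z \<in> W2 \<inter> msupp \<mu> \<Longrightarrow> \<bar>f' z\<bar> \<noteq> \<infinity>"
      "\<And>z w. z \<in> W2 \<inter> msupp \<mu> \<Longrightarrow> w \<in> W2 \<inter> msupp \<mu> \<Longrightarrow>
        \<bar>real_of_ereal (f' z) - real_of_ereal (f' w)\<bar> \<le> L2 * dist (\<phi> z) (\<phi> w)"
      by (rule tight_dual_pair_locally_Lipschitz[OF lip \<mu> \<pi> tight(2) U(1) chart U(2) xr]) blast
    \<comment> \<open>Inside \<open>M\<close> every point belongs to the support, so the Lipschitz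
      bounds hold on a full neighbourhood of \<open>x\<close>.\<close>
    define W where "W = W1 \<inter> W2 \<inter> M"
    have W: "open W" "x \<in> W" "W \<subseteq> U" "W \<subseteq> M" "W \<subseteq> W1 \<inter> msupp \<mu>" "W \<subseteq> W2 \<inter> msupp \<mu>"
      using W1(1-3) W2(1-3) M x by (auto simp: W_def)
    have "openin (top_of_set (\<phi> ` U)) (\<phi> ` W)"
      by (rule homeomorphism_imp_open_map[OF ch(3)]) (use W ch(1) in \<open>auto intro: open_subset\<close>)
    then have "open (\<phi> ` W)" using open_image openin_open_trans by blast
    then obtain e where e: "e > 0" "ball (\<phi> x) e \<subseteq> \<phi> ` W" using W(2) openE by blast
    \<comment> \<open>A ball in coordinates provides the convex open set on which segments can be
      drawn.\<close>
    define B where "B = ball (\<phi> x) e"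
    have B: "\<psi> p \<in> W" "\<phi> (\<psi> p) = p" if "p \<in> B" for p
      using that e(2) W(3) \<psi> by (auto simp: B_def subset_iff image_iff)
    define L where "L = max L1 L2"
    have lipL: "L-lipschitz_on B (\<lambda>p. real_of_ereal (h (\<psi> p)))"
      if h: "\<And>z w. z \<in> W \<Longrightarrow> w \<in> W \<Longrightarrow>
        \<bar>real_of_ereal (h z) - real_of_ereal (h w)\<bar> \<le> l * dist (\<phi> z) (\<phi> w)" and l: "l \<le> L"
      for h :: "'x \<Rightarrow> ereal" and l
    proof (rule lipschitz_onI)
      fix p q assume "p \<in> B" "q \<in> B"
      then have "\<bar>real_of_ereal (h (\<psi> p)) - real_of_ereal (h (\<psi> q))\<bar> \<le> l * dist p q"
        using h[of "\<psi> p" "\<psi> q"] B by simp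
      also have "\<dots> \<le> L * dist p q" using l by (intro mult_right_mono) auto
      finally show "dist (real_of_ereal (h (\<psi> p))) (real_of_ereal (h (\<psi> q))) \<le> L * dist p q"
        by (simp add: dist_real_def)
    qed (use W1(4) in \<open>simp add: L_def\<close>)
    define N where "N = \<phi> ` (U \<inter> M) - \<phi> ` (fst ` gradient_set A c \<pi> \<inter> (U \<inter> M))"
    have "lebesgue_null V N"
      using bspec[OF full[unfolded full_lebesgue_measure_in_charts_def] U(1)] by (simp add: N_def)
    then have N: "N \<in> null_sets lebesgue" using False by (simp add: lebesgue_null_def)
    have contact: "\<exists>k. k differentiable at p \<and> (\<forall>q\<in>B.
        real_of_ereal (f (\<psi> q)) - real_of_ereal (f (\<psi> p)) \<le> k q - k p \<and>
        real_of_ereal (f' (\<psi> q)) - real_of_ereal (f' (\<psi> p)) \<le> k q - k p)"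
      if p: "p \<in> B - N" for p
    proof -
      have "p \<in> \<phi> ` (U \<inter> M)" using p B[of p] W(3,4) by (metis DiffD1 IntI imageI subsetD)
      then obtain z where z: "z \<in> U" "p = \<phi> z" "z \<in> fst ` gradient_set A c \<pi>"
        using p by (auto simp: N_def)
      have pz: "\<psi> p = z" "z \<in> W" using B[of p] p \<psi>[OF z(1)] z(2) by auto
      obtain y where y: "(z, y) \<in> msupp \<pi>" "gradient_exists A (\<lambda>x'. c x' y) z"
        using z(3) by (auto simp: gradient_set_def)
      have pin: "p \<in> \<phi> ` U" using z(1,2) by simp
      have "((\<lambda>x'. c x' y) \<circ> \<psi>) differentiable (at p within \<phi> ` U)"
        using bspec[OF y(2)[unfolded gradient_exists_def] U(1)] z by (simp add: \<psi>_def)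
      then have diff: "((\<lambda>x'. c x' y) \<circ> \<psi>) differentiable at p"
        unfolding at_within_open[OF pin open_image] .
      \<comment> \<open>The value \<open>k y\<close> cancels; it is finite because
        \<open>h z + k y\<close> is real.\<close>
      have up: "real_of_ereal (h w) - real_of_ereal (h z) \<le> c w y - c z y"
        if t: "tight_dual_pair c \<pi> h k" and fin: "\<bar>h w\<bar> \<noteq> \<infinity>" "\<bar>h z\<bar> \<noteq> \<infinity>" for h k w
      proof -
        have "h w + k y \<le> ereal (c w y)" "h z + k y = ereal (c z y)"
          by (rule tight_dual_pairD[OF t] y)+
        then show ?thesis using fin by (cases "h w"; cases "h z"; cases "k y") auto
      qed
      have "real_of_ereal (f (\<psi> q)) - real_of_ereal (f (\<psi> p)) \<le> c (\<psi> q) y - c (\<psi> p) y"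
        "real_of_ereal (f' (\<psi> q)) - real_of_ereal (f' (\<psi> p)) \<le> c (\<psi> q) y - c (\<psi> p) y" if "q \<in> B" for q
        unfolding pz(1) using B(1)[OF that] pz(2) W(5,6)
        by (intro up[OF tight(1)] up[OF tight(2)] W1(5) W2(5); blast)+
      then show ?thesis using diff by (intro exI[of _ "(\<lambda>x'. c x' y) \<circ> \<psi>"]) simp
    qed
    define W' where "W' = U \<inter> \<phi> -` B"
    have "open W'"
      unfolding W'_def B_def by (intro continuous_open_preimage ch) auto
    moreover have "x \<in> W'" using U(2) e(1) by (simp add: W'_def B_def)
    moreover have "real_of_ereal (f z) - real_of_ereal (f' z) = real_of_ereal (f x) - real_of_ereal (f' x)"
      if z: "z \<in> W'" for z
    proof -
      have "real_of_ereal (f (\<psi> (\<phi> z))) - real_of_ereal (f' (\<psi> (\<phi> z))) =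
          real_of_ereal (f (\<psi> (\<phi> x))) - real_of_ereal (f' (\<psi> (\<phi> x)))"
      proof (rule common_upper_contact_imp_difference_eq[OF _ _ _ _ N contact])
        show "L-lipschitz_on B (\<lambda>p. real_of_ereal (f (\<psi> p)))"
          by (rule lipL[of f L1]) (use W(5) W1(6) in \<open>auto simp: L_def\<close>)
        show "L-lipschitz_on B (\<lambda>p. real_of_ereal (f' (\<psi> p)))"
          by (rule lipL[of f' L2]) (use W(6) W2(6) in \<open>auto simp: L_def\<close>)
      qed (use z e(1) in \<open>auto simp: W'_def B_def\<close>)
      then show ?thesis using z U(2) \<psi> by (simp add: W'_def)
    qed
    ultimately show ?thesis by (rule that)
  qed
qed

theorem theorem3:
  fixes V :: "'e::euclidean_space set"
    and A :: "('x::polish_space, 'e) chart set"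
    and c :: "'x \<Rightarrow> 'y::polish_space \<Rightarrow> real"
    and \<mu> :: "'x measure" and \<nu> :: "'y measure" and \<pi> :: "('x \<times> 'y) measure"
    and M :: "'x set"
  assumes "model_space V" and "smooth_atlas V A"
    and "borel_prob \<mu>" and "borel_prob \<nu>"
    and "\<And>x y. c x y \<ge> 0"
    and "continuous_on UNIV (\<lambda>(x, y). c x y)"
    and "locally_Lipschitz_locally_uniformly A (\<lambda>y x. c x y)"
    and "transport_cost c \<mu> \<nu> < \<infinity>"
    and "optimal_plan c \<mu> \<nu> \<pi>"
    and "emeasure \<mu> (msupp \<mu> - irregular_set \<mu> \<nu> \<pi>) = 1"
    and "M = interior (msupp \<mu> - irregular_set \<mu> \<nu> \<pi>)"
    and "connected M" and "closure M = msupp \<mu>"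
    and "full_lebesgue_measure_in_charts V A M (fst ` gradient_set A c \<pi>)"
  shows "kantorovich_potentials_unique c \<mu> \<nu>"
  unfolding kantorovich_potentials_unique_def
proof (intro ballI)
  fix f f' assume f: "f \<in> kantorovich_potentials c \<mu> \<nu>" "f' \<in> kantorovich_potentials c \<mu> \<nu>"
  have \<pi>: "\<pi> \<in> couplings \<mu> \<nu>" using assms(9) by (simp add: optimal_plan_def)
  define R where "R = msupp \<mu> - irregular_set \<mu> \<nu> \<pi>"
  note tight = kantorovich_potential_tight[OF assms(6,5,8,9) f(1)]
    kantorovich_potential_tight[OF assms(6,5,8,9) f(2)]
  have M: "open M" "M \<subseteq> R" using assms(11) interior_subset by (auto simp: R_def)
  define h where "h x = real_of_ereal (f x) - real_of_ereal (f' x)" for x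
  have loc: "\<forall>\<^sub>F z in at x within M. h x = h z" if "x \<in> M" for x
  proof -
    obtain W where W: "open W" "x \<in> W" "\<And>z. z \<in> W \<Longrightarrow> h z = h x"
      unfolding h_def
      by (rule tight_dual_pairs_difference_locally_constant[OF assms(1,2,7,3) \<pi> tight M[unfolded R_def] assms(14)
            \<open>x \<in> M\<close>]) blast
    show ?thesis
      unfolding eventually_at_topological
      by (intro exI[of _ W] conjI ballI impI W(1,2)) (rule W(3)[symmetric])
  qed
  have const: "h x = h z" if "x \<in> M" "z \<in> M" for x z
    by (rule connected_local_const[OF assms(12) that]) (use loc in blast)
  \<comment> \<open>If \<open>M\<close> were empty this value would be arbitrary, but then its
    closure, the support, would be empty as well.\<close>
  define k where "k = h (SOME x. x \<in> M)"
  have k: "h x = k" if "x \<in> M" for x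
    unfolding k_def by (rule const[OF that someI[of "\<lambda>x. x \<in> M", OF that]])
  \<comment> \<open>\<open>\<mu> M\<close> may be less than 1, so constancy on \<open>M\<close> alone does not suffice.\<close>
  have R: "f x - f' x = ereal k" if x: "x \<in> R" for x
  proof -
    obtain U \<phi> where U: "(U, \<phi>) \<in> A" "x \<in> U" and chart: "chart_on V (U, \<phi>)"
      using smooth_atlas_chartE[OF assms(2)] by metis
    obtain W1 L1 where W1: "open W1" "x \<in> W1" "W1 \<subseteq> U" "L1 \<ge> 0"
      "\<And>z. z \<in> W1 \<inter> msupp \<mu> \<Longrightarrow> \<bar>f z\<bar> \<noteq> \<infinity>"
      "\<And>z w. z \<in> W1 \<inter> msupp \<mu> \<Longrightarrow> w \<in> W1 \<inter> msupp \<mu> \<Longrightarrow>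
        \<bar>real_of_ereal (f z) - real_of_ereal (f w)\<bar> \<le> L1 * dist (\<phi> z) (\<phi> w)"
      by (rule tight_dual_pair_locally_Lipschitz[OF assms(7,3) \<pi> tight(1) U(1) chart U(2) x[unfolded R_def]]) blast
    obtain W2 L2 where W2: "open W2" "x \<in> W2" "W2 \<subseteq> U" "L2 \<ge> 0"
      "\<And>z. z \<in> W2 \<inter> msupp \<mu> \<Longrightarrow> \<bar>f' z\<bar> \<noteq> \<infinity>"
      "\<And>z w. z \<in> W2 \<inter> msupp \<mu> \<Longrightarrow> w \<in> W2 \<inter> msupp \<mu> \<Longrightarrow>
        \<bar>real_of_ereal (f' z) - real_of_ereal (f' w)\<bar> \<le> L2 * dist (\<phi> z) (\<phi> w)"
      by (rule tight_dual_pair_locally_Lipschitz[OF assms(7,3) \<pi> tight(2) U(1) chart U(2) x[unfolded R_def]]) blast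
    have xs: "x \<in> msupp \<mu>" using x by (simp add: R_def)
    have "\<bar>h x - k\<bar> \<le> 0"
    proof (rule field_le_epsilon)
      fix e :: real assume e: "e > 0"
      \<comment> \<open>The summand 1 keeps the denominator positive when both Lipschitz constants
        vanish.\<close>
      define r where "r = e / (L1 + L2 + 1)"
      have r: "r > 0" "(L1 + L2) * r \<le> e"
        using e W1(4) W2(4) by (auto simp: r_def field_simps)
      define G where "G = W1 \<inter> W2 \<inter> (U \<inter> \<phi> -` ball (\<phi> x) r)"
      have "open G"
        unfolding G_def by (intro open_Int W1 W2 continuous_open_preimage chart_onD[OF chart]) auto
      moreover have "x \<in> G" using W1 W2 U r by (auto simp: G_def)
      moreover have "x \<in> closure M" using xs assms(13) by simp
      ultimately have "G \<inter> M \<noteq> {}" by (meson disjoint_iff open_Int_closure_eq_empty)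
      then obtain z where z: "z \<in> M" "z \<in> G" by blast
      have zs: "z \<in> msupp \<mu>" using z(1) M(2) by (auto simp: R_def)
      have "\<bar>h x - h z\<bar> \<le> (L1 + L2) * dist (\<phi> x) (\<phi> z)"
        using W1(6)[of x z] W2(6)[of x z] W1(2) W2(2) z(2) xs zs
        by (auto simp: h_def G_def algebra_simps)
      also have "\<dots> \<le> (L1 + L2) * r"
        using z(2) W1(4) W2(4) by (intro mult_left_mono) (auto simp: G_def)
      finally show "\<bar>h x - k\<bar> \<le> 0 + e" using k[OF z(1)] r(2) by simp
    qed
    then show ?thesis
      using W1(5)[of x] W2(5)[of x] W1(2) W2(2) xs
      by (cases "f x"; cases "f' x") (auto simp: h_def)
  qed
  have "AE x in \<mu>. x \<in> R"
  proof -
    interpret prob_space \<mu> using assms(3) by (simp add: borel_prob_def)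
    \<comment> \<open>A set outside the \<sigma>-algebra has \<open>emeasure\<close> 0, so the value
      1 implies measurability.\<close>
    have "R \<in> events"
      using assms(10) emeasure_notin_sets[of R \<mu>] by (auto simp: R_def)
    then show ?thesis
      using assms(10) by (intro AE_prob_1) (simp add: R_def measure_def)
  qed
  then show "\<exists>k. AE x in \<mu>. f x - f' x = ereal k"
    using R by (intro exI[of _ k]) (auto elim: eventually_mono)
qed

end
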